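(* Let $U$ be an open subset of $\mathbb{R}^d$, $\mu$ a Federer measure on $U$ and $F:U\to\mathrm{Mat}_{m,n}$ a continuous map, and let $F_j:U\to\mathbb{R}^n$ denote the $j$-th row of $F$. Assume that the pair $(F_j,\mu)$ is good and non-planar for each $j=1,\dots,m$. Then $F_*\mu$ is extremal if and only if $F_*\mu$ is inhomogeneously extremal; and $F_*\mu$ is strongly extremal if and only if $F_*\mu$ is inhomogeneously strongly extremal.
   Context: $\mathrm{Mat}_{m,n}$: real $m\times n$ matrices; $\|\cdot\|$ Euclidean norm; $\Pi(\mathbf{x})=\prod_i|x_i|$, $\Pi_+(\mathbf{x})=\prod_i\max\{1,|x_i|\}$. For $Y\in\mathrm{Mat}_{m,n}$ and $\mathbf{z}\in\mathbb{R}^m$, $(Y;\mathbf{z})$ is VWA if there is $\varepsilon>0$ such that for arbitrarily large $Q>1$ there exist $\mathbf{q}\in\mathbb{Z}^n\setminus\{0\}$, $\mathbf{p}\in\mathbb{Z}^m$ with $\|Y\mathbf{q}+\mathbf{z}-\mathbf{p}\|^m<Q^{-1-\varepsilon}$ and $\|\mathbf{q}\|^n\le Q$; it is VWMA if the same holds with $\Pi(Y\mathbf{q}+\mathbf{z}-\mathbf{p})<Q^{-1-\varepsilon}$ and $\Pi_+(\mathbf{q})\le Q$. A measure $\nu$ on $\mathrm{Mat}_{m,n}$ is extremal (resp. strongly extremal) if $(Y;0)$ is not VWA (resp. not VWMA) for $\nu$-a.e. $Y$; it is inhomogeneously extremal (resp. inhomogeneously strongly extremal) if for every $\mathbf{z}\in\mathbb{R}^m$,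 $(Y;\mathbf{z})$ is not VWA (resp. not VWMA) for $\nu$-a.e. $Y$. $F_*\mu(S)=\mu(F^{-1}(S))$. All measures Radon. $\mu$ is $D$-Federer on open $U$ if $\mu(3V)<D\mu(V)$ for every ball $V\subset U$ centred in $\operatorname{supp}\mu$; Federer if for $\mu$-a.e. $x$ this holds on some neighbourhood of $x$ with some $D$. $\|f\|_{\mu,V}=\sup_{V\cap\operatorname{supp}\mu}|f|$; $f$ is $(C,\alpha)$-good on $U$ w.r.t. $\mu$ if for every ball $V\subset U$ centred in $\operatorname{supp}\mu$ and $\varepsilon>0$, $\mu(\{x\in V:|f(x)|<\varepsilon\})\le C(\varepsilon/\|f\|_{\mu,V})^\alpha\mu(V)$. For $\mathbf{f}=(f_1,\dots,f_n):U\to\mathbb{R}^n$, $(\mathbf{f},\mu)$ is good if for $\mu$-a.e. $x$ there are a neighbourhood $V$ of $x$ and $C,\alpha>0$ such that every real linear combination of $1,f_1,\dots,f_n$ is $(C,\alpha)$-good on $V$; it is non-planar if for every ball $V\subset U$ centred in $\operatorname{supp}\mu$, $\mathbf{f}(V\cap\operatorname{supp}\mu)$ is not contained in any affine hyperplane of $\mathbb{R}^n$. *)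

theory Defs
  imports "HOL-Analysis.Analysis"
begin

section \<open>Diophantine approximation of systems of affine forms\<close>

definition int_vecs :: "(real ^ 'k) set" where
  "int_vecs = {v. \<forall>i. v $ i \<in> \<int>}"

definition coord_prod :: "real ^ 'k \<Rightarrow> real" where
  "coord_prod x = (\<Prod>i\<in>UNIV. \<bar>x $ i\<bar>)"

definition coord_prod_plus :: "real ^ 'k \<Rightarrow> real" where
  "coord_prod_plus x = (\<Prod>i\<in>UNIV. max 1 \<bar>x $ i\<bar>)"

text \<open>
  An \<open>m \<times> n\<close> matrix is an element of \<open>real ^ 'n ^ 'm\<close>; thus \<open>m = CARD('m)\<close>, \<open>n = CARD('n)\<close>.
\<close>

definition VWA :: "real ^ 'n ^ 'm \<Rightarrow> real ^ 'm \<Rightarrow> bool" where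
  "VWA Y z \<longleftrightarrow>
    (\<exists>\<epsilon>>0. \<forall>Q0. \<exists>Q>Q0. Q > 1 \<and>
      (\<exists>q\<in>int_vecs - {0}. \<exists>p\<in>int_vecs.
        norm (Y *v q + z - p) ^ CARD('m) < Q powr (- 1 - \<epsilon>) \<and> norm q ^ CARD('n) \<le> Q))"

definition VWMA :: "real ^ 'n ^ 'm \<Rightarrow> real ^ 'm \<Rightarrow> bool" where
  "VWMA Y z \<longleftrightarrow>
    (\<exists>\<epsilon>>0. \<forall>Q0. \<exists>Q>Q0. Q > 1 \<and>
      (\<exists>q\<in>int_vecs - {0}. \<exists>p\<in>int_vecs.
        coord_prod (Y *v q + z - p) < Q powr (- 1 - \<epsilon>) \<and> coord_prod_plus q \<le> Q))"

definition extremal :: "(real ^ 'n ^ 'm) measure \<Rightarrow> bool" where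
  "extremal \<nu> \<longleftrightarrow> (AE Y in \<nu>. \<not> VWA Y 0)"

definition strongly_extremal :: "(real ^ 'n ^ 'm) measure \<Rightarrow> bool" where
  "strongly_extremal \<nu> \<longleftrightarrow> (AE Y in \<nu>. \<not> VWMA Y 0)"

definition inhom_extremal :: "(real ^ 'n ^ 'm) measure \<Rightarrow> bool" where
  "inhom_extremal \<nu> \<longleftrightarrow> (\<forall>z. AE Y in \<nu>. \<not> VWA Y z)"

definition inhom_strongly_extremal :: "(real ^ 'n ^ 'm) measure \<Rightarrow> bool" where
  "inhom_strongly_extremal \<nu> \<longleftrightarrow> (\<forall>z. AE Y in \<nu>. \<not> VWMA Y z)"

section \<open>Measures on an open set\<close>

text \<open>
  A measure on \<open>U\<close> has \<open>U\<close> as its space, rather than being a Borel measure on the whole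
  Euclidean space: a Radon measure on \<open>U\<close> may have infinite mass near the boundary of \<open>U\<close>.
\<close>

definition radon_measure_on :: "'a::euclidean_space set \<Rightarrow> 'a measure \<Rightarrow> bool" where
  "radon_measure_on U \<mu> \<longleftrightarrow>
    sets \<mu> = sets (restrict_space borel U) \<and>
    (\<forall>K. compact K \<and> K \<subseteq> U \<longrightarrow> emeasure \<mu> K < \<infinity>) \<and>
    (\<forall>A\<in>sets \<mu>. emeasure \<mu> A = (SUP K\<in>{K. compact K \<and> K \<subseteq> A}. emeasure \<mu> K))"

definition msupp :: "'a::euclidean_space measure \<Rightarrow> 'a set" where
  "msupp \<mu> = {x \<in> space \<mu>. \<forall>W. open W \<and> x \<in> W \<longrightarrow> emeasure \<mu> (W \<inter> space \<mu>) > 0}"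

text \<open>
  The ball \<open>3V\<close> need not lie in the space of \<open>\<mu>\<close>, whence the intersection.
\<close>

definition D_federer_on :: "real \<Rightarrow> 'a::euclidean_space set \<Rightarrow> 'a measure \<Rightarrow> bool" where
  "D_federer_on D W \<mu> \<longleftrightarrow>
    (\<forall>x\<in>msupp \<mu>. \<forall>r>0. ball x r \<subseteq> W \<longrightarrow>
      emeasure \<mu> (ball x (3 * r) \<inter> space \<mu>) < ennreal D * emeasure \<mu> (ball x r))"

definition federer_on :: "'a::euclidean_space set \<Rightarrow> 'a measure \<Rightarrow> bool" where
  "federer_on U \<mu> \<longleftrightarrow>
    (AE x in \<mu>. \<exists>W D. open W \<and> x \<in> W \<and> W \<subseteq> U \<and> D_federer_on D W \<mu>)"

section \<open>Good and non-planar pairs\<close>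

definition sup_norm_on :: "'a::euclidean_space measure \<Rightarrow> 'a set \<Rightarrow> ('a \<Rightarrow> real) \<Rightarrow> ennreal" where
  "sup_norm_on \<mu> V f = (SUP x \<in> V \<inter> msupp \<mu>. ennreal \<bar>f x\<bar>)"

text \<open>Extended power, meant for exponents \<open>a > 0\<close>.\<close>

definition epowr :: "ennreal \<Rightarrow> real \<Rightarrow> ennreal" where
  "epowr t a = (if t = \<infinity> then \<infinity> else ennreal (enn2real t powr a))"

text \<open>
  The quotient is taken in \<open>ennreal\<close>, so that it is infinite, and the inequality void, if \<open>f\<close>
  vanishes on \<open>V \<inter> msupp \<mu>\<close>; in particular the zero function is good.
\<close>

definition C_alpha_good_on ::
  "real \<Rightarrow> real \<Rightarrow> 'a::euclidean_space set \<Rightarrow> 'a measure \<Rightarrow> ('a \<Rightarrow> real) \<Rightarrow> bool" where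
  "C_alpha_good_on C \<alpha> W \<mu> f \<longleftrightarrow>
    (\<forall>x\<in>msupp \<mu>. \<forall>r>0. \<forall>\<epsilon>>0. ball x r \<subseteq> W \<longrightarrow>
      emeasure \<mu> {y \<in> ball x r. \<bar>f y\<bar> < \<epsilon>}
        \<le> ennreal C * epowr (ennreal \<epsilon> / sup_norm_on \<mu> (ball x r) f) \<alpha> * emeasure \<mu> (ball x r))"

definition good_pair ::
  "'a::euclidean_space set \<Rightarrow> ('a \<Rightarrow> real ^ 'n) \<Rightarrow> 'a measure \<Rightarrow> bool" where
  "good_pair U f \<mu> \<longleftrightarrow>
    (AE x in \<mu>. \<exists>W. open W \<and> x \<in> W \<and> W \<subseteq> U \<and>
      (\<exists>C>0. \<exists>\<alpha>>0. \<forall>c0. \<forall>c :: real ^ 'n.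
        C_alpha_good_on C \<alpha> W \<mu> (\<lambda>y. c0 + (\<Sum>i\<in>UNIV. c $ i * f y $ i))))"

definition nonplanar_pair ::
  "'a::euclidean_space set \<Rightarrow> ('a \<Rightarrow> real ^ 'n) \<Rightarrow> 'a measure \<Rightarrow> bool" where
  "nonplanar_pair U f \<mu> \<longleftrightarrow>
    (\<forall>x\<in>msupp \<mu>. \<forall>r>0. ball x r \<subseteq> U \<longrightarrow>
      \<not> (\<exists>a b. a \<noteq> 0 \<and> f ` (ball x r \<inter> msupp \<mu>) \<subseteq> {y. a \<bullet> y = b}))"

end

theory Submission
  imports Defs
begin

text \<open>
  Fix a shift \<open>z\<close>. Two distinct solutions \<open>(q, p)\<close>, \<open>(q', p')\<close> of the inhomogeneous inequalities
  at the same scale \<open>2 ^ s\<close> subtract to a solution of the homogeneous ones, so homogeneous extremality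
  says that for almost every \<open>x\<close> and all large \<open>s\<close> at most one pair solves the inhomogeneous inequalities
  with a slightly relaxed exponent; that is, off a set of small measure the relaxed solution sets are
  pairwise disjoint. Goodness and non-planarity make the solution set with the original exponent occupy an
  exponentially small proportion of a ball on which the relaxed inequalities still hold. A Vitali
  covering together with disjointness bounds the total measure of the original solution sets at
  scale \<open>2 ^ s\<close> by a geometric term, and the Borel-Cantelli lemma applies. The exceptional set of
  small measure is dealt with by a maximal inequality.
\<close>

text \<open>The surplus exponent is spent in stages: solutions carry \<open>\<epsilon>\<close>, the
  disjoint relaxed sets carry less, and differences of two solutions still carry
  \<open>\<epsilon> / 4\<close>. The first gap becomes the geometric factor
  \<open>\<rho> ^ s\<close>, the second absorbs all constants of the subtraction. A solution set is
  an intersection of strips, one for each row. To see that it is small in a ball it suffices that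
  one of its strips is small there, which is why goodness and non-planarity of the single rows are
  enough. The multiplicative inequality does not define such an intersection. A logarithmic grid
  splits it into boxes whose shapes come from a finite list independent of the scale, and each shape
  is treated as in the additive case. Disjointness replaces counting: the number of integer pairs at
  a given scale never enters. This matters in particular because \<open>p\<close> is unbounded. The
  price is that overlaps of the relaxed sets tend to zero in measure without any rate, so they
  cannot be summed over the scales and must be removed beforehand as one exceptional set.\<close>

section \<open>Measures on Euclidean space\<close>

text \<open>By second countability, countably many of the neighbourhoods \<open>V\<close> cover
  their union, so only countably many null sets are discarded. This allows goodness and the Federer
  property to be used on neighbourhoods that vary with the point.\<close>

lemma AE_locally:
  fixes M :: "'a::second_countable_topology measure"
  assumes "AE x in M. P x \<or> (\<exists>V. open V \<and> x \<in> V \<and> (AE y in M. y \<in> V \<longrightarrow> P y))"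
  shows "AE x in M. P x"
proof -
  define \<F> where "\<F> = {V. open V \<and> (AE y in M. y \<in> V \<longrightarrow> P y)}"
  obtain \<F>' where F': "\<F>' \<subseteq> \<F>" "countable \<F>'" "\<Union>\<F>' = \<Union>\<F>"
    using Lindelof[of \<F>] unfolding \<F>_def by auto
  have "AE y in M. \<forall>V\<in>\<F>'. y \<in> V \<longrightarrow> P y"
    using F' by (subst AE_ball_countable) (auto simp: \<F>_def)
  with assms show ?thesis
  proof eventually_elim
    case (elim x)
    show ?case
    proof (rule ccontr)
      assume "\<not> P x"
      with elim have "x \<in> \<Union>\<F>" by (auto simp: \<F>_def)
      with F' elim \<open>\<not> P x\<close> show False by blast
    qed
  qed
qed

lemma AE_msupp:
  fixes M :: "'a::euclidean_space measure"
  assumes "\<And>V. open V \<Longrightarrow> V \<inter> space M \<in> sets M"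
  shows "AE x in M. x \<in> msupp M"
proof (rule AE_locally, rule AE_I2)
  fix x assume x: "x \<in> space M"
  show "x \<in> msupp M \<or> (\<exists>V. open V \<and> x \<in> V \<and> (AE y in M. y \<in> V \<longrightarrow> y \<in> msupp M))"
  proof (cases "x \<in> msupp M")
    case False
    with x obtain V where V: "open V" "x \<in> V" "emeasure M (V \<inter> space M) = 0"
      unfolding msupp_def by (auto simp: not_less)
    have "AE y in M. y \<notin> V \<inter> space M"
      using V assms by (intro AE_not_in) (auto simp: null_sets_def)
    then have "AE y in M. y \<in> V \<longrightarrow> y \<in> msupp M"
      using AE_space by eventually_elim auto
    with V show ?thesis by blast
  qed auto
qed

text \<open>Subadditivity for the possibly overlapping \<open>P i\<close>, additivity for the
  disjoint \<open>Q i\<close>. It serves for the balls of a Vitali family and again for the solution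
  sets of all integer pairs.\<close>

lemma emeasure_UN_le_cmult_disjoint:
  fixes \<kappa> :: ennreal
  assumes "countable C" and P: "\<And>i. i \<in> C \<Longrightarrow> P i \<in> sets M" and Q: "\<And>i. i \<in> C \<Longrightarrow> Q i \<in> sets M"
    and disj: "disjoint_family_on Q C"
    and le: "\<And>i. i \<in> C \<Longrightarrow> emeasure M (P i) \<le> \<kappa> * emeasure M (Q i)"
    and X: "X \<in> sets M" "\<And>i. i \<in> C \<Longrightarrow> Q i \<subseteq> X"
  shows "emeasure M (\<Union>i\<in>C. P i) \<le> \<kappa> * emeasure M X"
proof -
  \<comment> \<open>Indices outside \<open>T\<close> are given the empty set, so finite and infinite
    \<open>C\<close> are treated alike.\<close>
  define f where "f = from_nat_into C"
  define T where "T = to_nat_on C ` C"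
  define P' where "P' n = (if n \<in> T then P (f n) else {})" for n
  define Q' where "Q' n = (if n \<in> T then Q (f n) else {})" for n
  have fT: "f n \<in> C" if "n \<in> T" for n
    using that assms(1) unfolding f_def T_def by auto
  have finj: "f m \<noteq> f n" if "m \<in> T" "n \<in> T" "m \<noteq> n" for m n
    using that assms(1) unfolding f_def T_def by auto
  have PM: "P' n \<in> sets M" and QM: "Q' n \<in> sets M" for n
    using P Q fT by (auto simp: P'_def Q'_def)
  have disj': "disjoint_family Q'"
    using disj fT finj unfolding disjoint_family_on_def Q'_def by auto
  have "(\<Union>i\<in>C. P i) \<subseteq> (\<Union>n. P' n)"
  proof
    fix x assume "x \<in> (\<Union>i\<in>C. P i)"
    then obtain i where i: "i \<in> C" "x \<in> P i" by auto
    then have "x \<in> P' (to_nat_on C i)"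
      using assms(1) unfolding P'_def f_def T_def by auto
    then show "x \<in> (\<Union>n. P' n)" by blast
  qed
  then have "emeasure M (\<Union>i\<in>C. P i) \<le> emeasure M (\<Union>n. P' n)"
    using PM by (intro emeasure_mono) auto
  also have "\<dots> \<le> (\<Sum>n. emeasure M (P' n))"
    by (rule emeasure_subadditive_countably) (use PM in auto)
  also have "\<dots> \<le> (\<Sum>n. \<kappa> * emeasure M (Q' n))"
    by (rule suminf_le) (use le fT in \<open>auto simp: P'_def Q'_def\<close>)
  also have "\<dots> = \<kappa> * emeasure M (\<Union>n. Q' n)"
    using suminf_emeasure[OF _ disj', of M] QM by (simp add: image_subset_iff)
  also have "\<dots> \<le> \<kappa> * emeasure M X"
    by (intro mult_left_mono emeasure_mono) (use X fT in \<open>auto simp: Q'_def split: if_splits\<close>)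
  finally show ?thesis .
qed

text \<open>The 5-fold enlargements of a disjoint subfamily cover \<open>N\<close>, and each is paid
  for inside its own ball. The bound is for a superset \<open>N'\<close> because \<open>N\<close>
  need not be measurable. With \<open>Y\<close> the whole space this yields the maximal inequality,
  with \<open>Y\<close> a solution set the contraction estimate.\<close>

lemma Vitali_emeasure_bound:
  fixes M :: "'a::euclidean_space measure" and \<kappa> :: ennreal
  assumes balls: "\<And>x r. ball x r \<inter> space M \<in> sets M"
    and X: "X \<in> sets M" and Y: "Y \<in> sets M"
    and r: "\<And>x. x \<in> N \<Longrightarrow> 0 < r x \<and> r x \<le> B"
    and le: "\<And>x. x \<in> N \<Longrightarrow>
      emeasure M (ball x (5 * r x) \<inter> Y) \<le> \<kappa> * emeasure M (ball x (r x) \<inter> X)"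
  obtains N' where "N' \<in> sets M" "N \<inter> Y \<subseteq> N'" "emeasure M N' \<le> \<kappa> * emeasure M X"
proof -
  have "N \<subseteq> (\<Union>x\<in>N. ball x (r x))" using r by fastforce
  then obtain C where C: "countable C" "C \<subseteq> N"
    "pairwise (\<lambda>i j. disjnt (ball i (r i)) (ball j (r j))) C"
    "N \<subseteq> (\<Union>i\<in>C. ball i (5 * r i))"
    by (rule Vitali_covering_lemma_balls[where a="\<lambda>x. x" and K=N and r=r and B=B]) (use r in auto)
  have sets: "ball x e \<inter> Z \<in> sets M" if "Z \<in> sets M" for x e Z
  proof -
    have "ball x e \<inter> Z = (ball x e \<inter> space M) \<inter> Z"
      using sets.sets_into_space[OF that] by auto
    then show ?thesis using balls that by auto
  qed
  show ?thesis
  proof (rule that)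
    show "(\<Union>x\<in>C. ball x (5 * r x) \<inter> Y) \<in> sets M"
      using C(1) sets[OF Y] by (intro sets.countable_UN'') auto
    show "N \<inter> Y \<subseteq> (\<Union>x\<in>C. ball x (5 * r x) \<inter> Y)" using C(4) by blast
    show "emeasure M (\<Union>x\<in>C. ball x (5 * r x) \<inter> Y) \<le> \<kappa> * emeasure M X"
    proof (rule emeasure_UN_le_cmult_disjoint[where Q = "\<lambda>x. ball x (r x) \<inter> X"])
      show "disjoint_family_on (\<lambda>x. ball x (r x) \<inter> X) C"
        using C(3) unfolding pairwise_def disjoint_family_on_def disjnt_def by blast
    qed (use C sets X Y le in auto)
  qed
qed

lemma open_abs_less:
  fixes f :: "'a::topological_space \<Rightarrow> real"
  assumes "open W" "continuous_on W f"
  shows "open {y \<in> W. \<bar>f y\<bar> < e}"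
proof -
  have "continuous_on W (\<lambda>y. \<bar>f y\<bar>)" using assms(2) by (intro continuous_intros)
  then have "open (W \<inter> (\<lambda>y. \<bar>f y\<bar>) -` {..<e})"
    using assms(1) by (intro continuous_open_preimage) auto
  also have "W \<inter> (\<lambda>y. \<bar>f y\<bar>) -` {..<e} = {y \<in> W. \<bar>f y\<bar> < e}" by auto
  finally show ?thesis .
qed

lemma open_all_abs_less:
  fixes g :: "'i \<Rightarrow> 'a::topological_space \<Rightarrow> real"
  assumes "finite I" "open W" "\<And>i. i \<in> I \<Longrightarrow> continuous_on W (g i)"
  shows "open {y \<in> W. \<forall>i\<in>I. \<bar>g i y\<bar> < e i}"
proof -
  have "open (W \<inter> (\<Inter>i\<in>I. {y \<in> W. \<bar>g i y\<bar> < e i}))"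
    using assms open_abs_less by (intro open_Int open_INT) auto
  also have "W \<inter> (\<Inter>i\<in>I. {y \<in> W. \<bar>g i y\<bar> < e i}) = {y \<in> W. \<forall>i\<in>I. \<bar>g i y\<bar> < e i}" by auto
  finally show ?thesis .
qed

lemma ennreal_inverse_antimono_le: "(a::ennreal) \<le> b \<Longrightarrow> inverse b \<le> inverse a"
  by (simp add: less_eq_ennreal.rep_eq inverse_ennreal.rep_eq ereal_inverse_antimono)

lemma epowr_le:
  assumes "t \<le> ennreal u" "0 \<le> u" "0 \<le> a"
  shows "epowr t a \<le> ennreal (u powr a)"
proof -
  have "t \<noteq> \<infinity>" using assms(1) by (auto simp: top_unique)
  moreover have "enn2real t \<le> u"
    using assms by (simp add: enn2real_leI)
  ultimately show ?thesis
    using assms by (auto simp: epowr_def intro!: ennreal_leI powr_mono2)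
qed

section \<open>The contracting property\<close>

text \<open>Two triplings, because a single one falls short of the Vitali factor 5.\<close>

lemma D_federer_on_9:
  assumes "D_federer_on D W M" "x \<in> msupp M" "0 < r" "ball x (3 * r) \<subseteq> W" "W \<subseteq> space M"
  shows "emeasure M (ball x (9 * r)  \<inter> space M) \<le> ennreal D * ennreal D * emeasure M (ball x r)"
proof -
  have sub: "ball x r \<subseteq> ball x (3 * r)" using assms(3) by auto
  have "emeasure M (ball x (3 * (3 * r)) \<inter> space M) < ennreal D * emeasure M (ball x (3 * r))"
    using assms unfolding D_federer_on_def by (metis mult_pos_pos zero_less_numeral)
  moreover have "emeasure M (ball x (3 * r) \<inter> space M) < ennreal D * emeasure M (ball x r)"
    using assms sub unfolding D_federer_on_def by (metis order_trans)
  moreover have "ball x (3 * r) \<inter> space M = ball x (3 * r)" using assms by auto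
  ultimately have "emeasure M (ball x (3 * r)) \<le> ennreal D * emeasure M (ball x r)"
    "emeasure M (ball x (9 * r) \<inter> space M) \<le> ennreal D * emeasure M (ball x (3 * r))"
    by (simp_all add: less_imp_le)
  then have "emeasure M (ball x (9 * r) \<inter> space M) \<le> ennreal D * (ennreal D * emeasure M (ball x r))"
    by (meson mult_left_mono order_trans zero_le)
  then show ?thesis by (simp add: mult.assoc)
qed

text \<open>The radii \<open>2 * r / 9 ^ k\<close> discretise the search for a largest ball about
  \<open>x\<close> inside the relaxed set; the ratio 9 is the one controlled by
  \<open>D_federer_on_9\<close>. The initial radius \<open>2 * r\<close> is large enough to reach
  every point of \<open>ball x0 r\<close> and small enough to stay in \<open>W\<close>.\<close>

lemma contracting_ball:
  fixes M :: "'a::euclidean_space measure" and g :: "'i \<Rightarrow> 'a \<Rightarrow> real"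
  assumes "0 < r" and W: "W = ball x0 (3 * r)" "W \<subseteq> space M" and opn: "\<And>V. open V \<Longrightarrow> V \<inter> space M \<in> sets M"
    and fed: "D_federer_on D W M"
    and I: "finite I" and cont: "\<And>i. i \<in> I \<Longrightarrow> continuous_on W (g i)"
    and good: "\<And>i. i \<in> I \<Longrightarrow> C_alpha_good_on C \<alpha> W M (g i)" and "0 < \<alpha>"
    and low: "i0 \<in> I" "y0 \<in> ball x0 r \<inter> msupp M" "\<theta>' i0 \<le> \<bar>g i0 y0\<bar>"
    and \<theta>: "\<And>i. i \<in> I \<Longrightarrow> 0 < \<theta>' i" "\<And>i. i \<in> I \<Longrightarrow> \<theta> i \<le> \<rho> * \<theta>' i" and "0 < \<rho>"
    and \<theta>\<theta>': "\<And>i. i \<in> I \<Longrightarrow> \<theta> i \<le> \<theta>' i"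
    and x: "x \<in> ball x0 r" "x \<in> msupp M" "\<And>i. i \<in> I \<Longrightarrow> \<bar>g i x\<bar> < \<theta> i"
  obtains k :: nat where "1 \<le> k" "ball x (2 * r / 9 ^ k) \<inter> msupp M \<subseteq> {y \<in> W. \<forall>i\<in>I. \<bar>g i y\<bar> < \<theta>' i}"
    "emeasure M (ball x (5 * (2 * r / 9 ^ k)) \<inter> {y \<in> W. \<forall>i\<in>I. \<bar>g i y\<bar> < \<theta> i})
       \<le> ennreal C * ennreal (\<rho> powr \<alpha>) * (ennreal D * ennreal D) * emeasure M (ball x (2 * r / 9 ^ k))"
proof -
  define J where "J = {y \<in> W. \<forall>i\<in>I. \<bar>g i y\<bar> < \<theta> i}"
  define J' where "J' = {y \<in> W. \<forall>i\<in>I. \<bar>g i y\<bar> < \<theta>' i}"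
  have "open W" using W by auto
  have openJ: "open {y \<in> W. \<forall>i\<in>I. \<bar>g i y\<bar> < \<eta> i}" for \<eta>
    by (rule open_all_abs_less) (use I \<open>open W\<close> cont in auto)
  have ballW: "ball x s \<subseteq> W" if "s \<le> 2 * r" for s
  proof
    fix y assume "y \<in> ball x s"
    then have "dist x0 y < 3 * r" using x(1) that dist_triangle[of x0 y x] by auto
    then show "y \<in> W" by (simp add: W)
  qed
  \<comment> \<open>Fitting is tested on the support only: failure then provides a support point,
    and such points are what \<open>sup_norm_on\<close> ranges over.\<close>
  define P where "P k \<longleftrightarrow> ball x (2 * r / 9 ^ k) \<inter> msupp M \<subseteq> J'" for k :: nat
  have "\<exists>k. P k"
  proof -
    have "x \<in> J'" using x \<theta>\<theta>' ballW[of "2 * r"] \<open>0 < r\<close> by (fastforce simp: J'_def)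
    then obtain e where e: "e > 0" "ball x e \<subseteq> J'" using openJ[of \<theta>'] open_contains_ball J'_def by metis
    obtain k where "inverse 9 ^ k < e / (2 * r)"
      using real_arch_pow_inv[of "e / (2 * r)" "inverse 9"] e \<open>0 < r\<close> by auto
    then have "2 * r / 9 ^ k < e" using \<open>0 < r\<close> by (simp add: field_simps)
    then have "ball x (2 * r / 9 ^ k) \<subseteq> J'" using e by force
    then show ?thesis by (auto simp: P_def)
  qed
  \<comment> \<open>The first radius \<open>2 r / 9 ^ k\<close> at which the ball fits into the relaxed set: the ball nine times as
     large does not, so there some \<open>\<bar>g i\<bar>\<close> has supremum at least \<open>\<theta>' i\<close>, and goodness applies to it.\<close>
  define k where "k = (LEAST k. P k)"
  have Pk: "P k" using \<open>\<exists>k. P k\<close> unfolding k_def by (rule LeastI_ex)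
  \<comment> \<open>The point \<open>y0\<close> is in the initial ball and violates the relaxed
    inequality \<open>i0\<close>, so the least \<open>k\<close> has a predecessor.\<close>
  have "\<not> P 0"
  proof -
    have "y0 \<in> ball x (2 * r)" using x(1) low(2) dist_triangle[of x y0 x0] by (auto simp: dist_commute)
    moreover have "y0 \<notin> J'" using low \<theta> by (force simp: J'_def)
    ultimately show ?thesis using low by (auto simp: P_def)
  qed
  then have "1 \<le> k" using Pk by (cases k) auto
  define s where "s = 2 * r / 9 ^ k"
  have s9: "2 * r / 9 ^ (k - 1) = 9 * s" using \<open>1 \<le> k\<close> by (cases k) (auto simp: s_def)
  have "s > 0" using \<open>0 < r\<close> by (simp add: s_def)
  have "9 * s \<le> 2 * r"
    unfolding s9[symmetric] using \<open>0 < r\<close> by (simp add: field_simps)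
  have "\<not> P (k - 1)" using \<open>1 \<le> k\<close> not_less_Least[of "k - 1" P] by (auto simp: k_def)
  then obtain y where y: "y \<in> ball x (9 * s) \<inter> msupp M" "y \<notin> J'" unfolding P_def s9 by blast
  have 9: "ball x (9 * s) \<subseteq> W" by (rule ballW) fact
  with y obtain i where i: "i \<in> I" "\<theta>' i \<le> \<bar>g i y\<bar>" by (force simp: J'_def not_less)
  have sup: "ennreal (\<theta>' i) \<le> sup_norm_on M (ball x (9 * s)) (g i)"
    unfolding sup_norm_on_def using y i by (intro SUP_upper2[of y] ennreal_leI) auto
  \<comment> \<open>Goodness is applied at the level \<open>\<rho> * \<theta>' i\<close>, which
    dominates \<open>\<theta> i\<close>; relative to a supremum of at least
    \<open>\<theta>' i\<close> this level is at most \<open>\<rho>\<close>.\<close>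
  have "ennreal (\<rho> * \<theta>' i) / sup_norm_on M (ball x (9 * s)) (g i) \<le> ennreal (\<rho> * \<theta>' i) / ennreal (\<theta>' i)"
    unfolding divide_ennreal_def by (intro mult_left_mono ennreal_inverse_antimono_le sup) auto
  also have "\<dots> = ennreal \<rho>"
    using \<theta>(1)[OF i(1)] \<open>0 < \<rho>\<close> by (simp add: divide_ennreal)
  finally have ep: "epowr (ennreal (\<rho> * \<theta>' i) / sup_norm_on M (ball x (9 * s)) (g i)) \<alpha> \<le> ennreal (\<rho> powr \<alpha>)"
    using \<open>0 < \<rho>\<close> \<open>0 < \<alpha>\<close> by (intro epowr_le) auto
  have setsM: "V \<in> sets M" if "open V" "V \<subseteq> W" for V
    using opn[OF that(1)] that(2) W(2) by (simp add: Int_absorb2)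
  have op: "{z \<in> ball x (9 * s). \<bar>g i z\<bar> < \<rho> * \<theta>' i} \<in> sets M"
  proof (rule setsM)
    show "open {z \<in> ball x (9 * s). \<bar>g i z\<bar> < \<rho> * \<theta>' i}"
      using continuous_on_subset[OF cont[OF i(1)] 9] by (intro open_abs_less) auto
  qed (use 9 in auto)
  have "emeasure M (ball x (5 * s) \<inter> J) \<le> emeasure M {z \<in> ball x (9 * s). \<bar>g i z\<bar> < \<rho> * \<theta>' i}"
    using \<open>s > 0\<close> i \<theta>(2)[OF i(1)] by (intro emeasure_mono op) (auto simp: J_def)
  also have "\<dots> \<le> ennreal C * epowr (ennreal (\<rho> * \<theta>' i) / sup_norm_on M (ball x (9 * s)) (g i)) \<alpha>
       * emeasure M (ball x (9 * s))"
    using good[OF i(1)] x(2) \<open>s > 0\<close> 9 \<theta>(1)[OF i(1)] \<open>0 < \<rho>\<close>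
    unfolding C_alpha_good_on_def by simp
  also have "\<dots> \<le> ennreal C * ennreal (\<rho> powr \<alpha>) * (ennreal D * ennreal D * emeasure M (ball x s))"
  proof (intro mult_mono ep order_refl)
    have "ball x (9 * s) \<inter> space M = ball x (9 * s)" using 9 W by auto
    then show "emeasure M (ball x (9 * s)) \<le> ennreal D * ennreal D * emeasure M (ball x s)"
      using D_federer_on_9[OF fed x(2) \<open>s > 0\<close> ballW W(2)] \<open>9 * s \<le> 2 * r\<close> \<open>s > 0\<close> by simp
  qed auto
  finally show ?thesis
    using that[OF \<open>1 \<le> k\<close>] Pk unfolding P_def J_def J'_def s_def by (simp add: mult.assoc)
qed

section \<open>Disjointness and Borel-Cantelli on one ball\<close>

text \<open>All arithmetic is condensed into \<open>uniq\<close>; the indices \<open>a\<close> are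
  arbitrary. The lower bound \<open>c\<close>, uniform in \<open>a\<close>, exceeds
  \<open>\<theta>' s i0\<close> for large \<open>s\<close> and so keeps the relaxed sets from
  swallowing the support in \<open>ball x0 r\<close>. The ratio \<open>\<rho> ^ s\<close> of the
  thresholds, raised to \<open>\<alpha>\<close>, becomes the geometric term.\<close>

lemma local_transference:
  fixes M :: "'a::euclidean_space measure" and g :: "'b \<Rightarrow> 'i \<Rightarrow> 'a \<Rightarrow> real"
  assumes "0 < r" and W: "W = ball x0 (3 * r)" "W \<subseteq> space M" and opn: "\<And>V. open V \<Longrightarrow> V \<inter> space M \<in> sets M"
    and fin: "emeasure M W < \<infinity>"
    and fed: "D_federer_on D W M"
    and I: "finite I"
    and cont: "\<And>s a i. a \<in> A s \<Longrightarrow> i \<in> I \<Longrightarrow> continuous_on W (g a i)"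
    and good: "\<And>s a i. a \<in> A s \<Longrightarrow> i \<in> I \<Longrightarrow> C_alpha_good_on C \<alpha> W M (g a i)" and "0 < \<alpha>"
    and "0 < c"
    and low: "\<And>s a i. a \<in> A s \<Longrightarrow> i \<in> I \<Longrightarrow> \<exists>y \<in> ball x0 r \<inter> msupp M. c \<le> \<bar>g a i y\<bar>"
    and A: "\<And>s. countable (A s)"
    and \<theta>: "\<And>s i. i \<in> I \<Longrightarrow> 0 < \<theta>' s i" "\<And>s i. i \<in> I \<Longrightarrow> \<theta> s i \<le> \<rho> ^ s * \<theta>' s i" and \<rho>: "0 < \<rho>" "\<rho> < 1"
    and i0: "i0 \<in> I" "(\<lambda>s. \<theta>' s i0) \<longlonglongrightarrow> 0"
    and uniq: "AE x in M. x \<in> W \<longrightarrow> (\<forall>\<^sub>F s in sequentially. \<forall>a\<in>A s. \<forall>b\<in>A s.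
       (\<forall>i\<in>I. \<bar>g a i x\<bar> < \<theta>' s i) \<and> (\<forall>i\<in>I. \<bar>g b i x\<bar> < \<theta>' s i) \<longrightarrow> a = b)"
  shows "AE x in M. x \<in> ball x0 r \<longrightarrow> (\<forall>\<^sub>F s in sequentially. \<forall>a\<in>A s. \<not> (\<forall>i\<in>I. \<bar>g a i x\<bar> < \<theta> s i))"
proof -
  define J where "J s a = {y \<in> W. \<forall>i\<in>I. \<bar>g a i y\<bar> < \<theta> s i}" for s a
  define J' where "J' s a = {y \<in> W. \<forall>i\<in>I. \<bar>g a i y\<bar> < \<theta>' s i}" for s a
  have "open W" using W by auto
  have setsM: "V \<in> sets M" if "open V" "V \<subseteq> W" for V
    using opn[OF that(1)] that(2) W(2) by (simp add: Int_absorb2)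
  have meas: "{y \<in> W. \<forall>i\<in>I. \<bar>g a i y\<bar> < \<eta> i} \<in> sets M" if a: "a \<in> A s" for a s \<eta>
  proof (rule setsM)
    show "open {y \<in> W. \<forall>i\<in>I. \<bar>g a i y\<bar> < \<eta> i}"
      by (rule open_all_abs_less) (use I \<open>open W\<close> cont[OF a] in auto)
  qed auto
  have JM: "J s a \<in> sets M" and J'M: "J' s a \<in> sets M" if "a \<in> A s" for s a
    unfolding J_def J'_def using meas[OF that] by auto
  have WM: "W \<in> sets M" using setsM \<open>open W\<close> by auto
  define H where "H s = (\<Union>a\<in>A s. \<Union>b\<in>A s - {a}. J' s a \<inter> J' s b)" for s
  have HM: "H s \<in> sets M" for s
    unfolding H_def using A J'M
    by (intro sets.countable_UN'' countable_Diff sets.Int) auto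
  have HW: "H s \<subseteq> W" for s by (auto simp: H_def J'_def)
  define T where "T k = (\<Union>s\<in>{k..}. H s)" for k :: nat
  have TM: "T k \<in> sets M" for k unfolding T_def using HM by auto
  have TW: "T k \<subseteq> W" for k using HW by (auto simp: T_def)
  \<comment> \<open>\<open>T k\<close> collects the overlaps of relaxed sets at all scales from
    \<open>k\<close> on. By \<open>uniq\<close> these decreasing sets have null intersection, and
    the finite mass of \<open>W\<close> turns this into convergence of the measures.\<close>
  have T0: "(\<lambda>k. emeasure M (T k)) \<longlonglongrightarrow> 0"
  proof -
    have "(\<lambda>k. emeasure M (T k)) \<longlonglongrightarrow> emeasure M (\<Inter>k. T k)"
    proof (rule Lim_emeasure_decseq)
      show "decseq T" unfolding T_def decseq_def by (intro allI impI UN_mono) auto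
      show "emeasure M (T k) \<noteq> \<infinity>" for k
        using emeasure_mono[OF TW[of k] WM] fin by auto
    qed (use TM in auto)
    moreover have "AE x in M. x \<notin> (\<Inter>k. T k)"
      using uniq
    proof eventually_elim
      case (elim x)
      show ?case
      proof
        assume x: "x \<in> (\<Inter>k. T k)"
        with TW have "x \<in> W" by blast
        with elim obtain n where n: "\<forall>s\<ge>n. \<forall>a\<in>A s. \<forall>b\<in>A s.
          (\<forall>i\<in>I. \<bar>g a i x\<bar> < \<theta>' s i) \<and> (\<forall>i\<in>I. \<bar>g b i x\<bar> < \<theta>' s i) \<longrightarrow> a = b"
          by (auto simp: eventually_sequentially)
        from x have "x \<in> T n" by blast
        then obtain s a b where "s \<ge> n" "a \<in> A s" "b \<in> A s" "a \<noteq> b" "x \<in> J' s a" "x \<in> J' s b"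
          unfolding T_def H_def by auto
        with n show False unfolding J'_def by blast
      qed
    qed
    then have "emeasure M {x \<in> space M. x \<in> (\<Inter>k. T k)} = 0"
      by (rule emeasure_eq_0_AE)
    moreover have "{x \<in> space M. x \<in> (\<Inter>k. T k)} = (\<Inter>k. T k)"
      using TW[of 0] W(2) by blast
    ultimately show ?thesis by simp
  qed
  have supp: "AE x in M. x \<in> msupp M" by (rule AE_msupp) fact
  define \<kappa> where "\<kappa> s = ennreal C * ennreal ((\<rho> ^ s) powr \<alpha>) * (ennreal D * ennreal D)" for s :: nat
  have ballW: "ball x s \<subseteq> W" if "x \<in> ball x0 r" "s \<le> 2 * r" for s x
  proof
    fix y assume "y \<in> ball x s"
    then have "dist x0 y < 3 * r" using that dist_triangle[of x0 y x] by auto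
    then show "y \<in> W" by (simp add: W)
  qed
  have rad: "0 < 2 * r / 9 ^ k" "2 * r / 9 ^ k \<le> 2 * r" "1 \<le> k \<Longrightarrow> 9 * (2 * r / 9 ^ k) \<le> 2 * r" for k :: nat
  proof -
    show "0 < 2 * r / 9 ^ k" "2 * r / 9 ^ k \<le> 2 * r"
      using \<open>0 < r\<close> by (auto simp: divide_le_eq)
    show "9 * (2 * r / 9 ^ k) \<le> 2 * r" if "1 \<le> k"
      using that \<open>0 < r\<close> by (cases k) (auto simp: divide_le_eq)
  qed
  \<comment> \<open>The bound is the maximal inequality applied to an exceptional set of measure
    below \<open>\<delta>\<close>: a factor 2 for "more than half", and the square of the Federer
    constant. The form \<open>max 0 D\<close> is the real value behind
    \<open>ennreal D\<close>.\<close>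
  have main: "\<exists>N\<in>sets M. emeasure M N \<le> ennreal (2 * (max 0 D * max 0 D) * \<delta>) \<and>
    (AE x in M. x \<in> ball x0 r \<longrightarrow> x \<in> N \<or>
       (\<forall>\<^sub>F s in sequentially. \<forall>a\<in>A s. \<not> (\<forall>i\<in>I. \<bar>g a i x\<bar> < \<theta> s i)))"
    if "0 < \<delta>" for \<delta> :: real
  proof -
    have "\<forall>\<^sub>F k in sequentially. emeasure M (T k) < ennreal \<delta>"
      using order_tendstoD(2)[OF T0] \<open>0 < \<delta>\<close> by auto
    moreover have "\<forall>\<^sub>F s in sequentially. \<theta>' s i0 < c"
      using order_tendstoD(2)[OF i0(2)] \<open>0 < c\<close> by auto
    ultimately obtain s0 where s0: "emeasure M (T s0) < ennreal \<delta>" "\<And>s. s \<ge> s0 \<Longrightarrow> \<theta>' s i0 < c"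
      unfolding eventually_sequentially by (meson nat_le_linear order_trans order_refl)
    define B where "B = T s0"
    have BM: "B \<in> sets M" unfolding B_def by (rule TM)
    \<comment> \<open>By the maximal inequality, the points about which \<open>B\<close> fills more than half of some ball are few.
       About all other points, half of each ball consists of points where the relaxed sets are disjoint.\<close>
    define N0 where "N0 = {x \<in> ball x0 r \<inter> msupp M. \<exists>k::nat. 1 \<le> k \<and>
      2 * emeasure M (ball x (2 * r / 9 ^ k) - B) < emeasure M (ball x (2 * r / 9 ^ k))}"
    have "\<forall>x\<in>N0. \<exists>k::nat. 1 \<le> k \<and>
      2 * emeasure M (ball x (2 * r / 9 ^ k) - B) < emeasure M (ball x (2 * r / 9 ^ k))"
      by (auto simp: N0_def)
    then obtain K where K: "\<And>x. x \<in> N0 \<Longrightarrow> 1 \<le> (K x :: nat)"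
      "\<And>x. x \<in> N0 \<Longrightarrow> 2 * emeasure M (ball x (2 * r / 9 ^ K x) - B) < emeasure M (ball x (2 * r / 9 ^ K x))"
      by (metis (no_types, lifting))
    have ballM: "ball x (2 * r / 9 ^ k) \<in> sets M" if "x \<in> ball x0 r" for x k
      using ballW[OF that rad(2)] by (intro setsM) auto
    obtain N where N: "N \<in> sets M" "N0 \<inter> space M \<subseteq> N"
      "emeasure M N \<le> (ennreal D * ennreal D * 2) * emeasure M B"
    proof (rule Vitali_emeasure_bound[of M B "space M" N0 "\<lambda>x. 2 * r / 9 ^ K x" "2 * r" "ennreal D * ennreal D * 2"])
      fix x assume x: "x \<in> N0"
      let ?b = "ball x (2 * r / 9 ^ K x)"
      have x': "x \<in> ball x0 r" "x \<in> msupp M" using x by (auto simp: N0_def)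
      have "emeasure M ?b = emeasure M (?b - B) + emeasure M (?b \<inter> B)"
        using ballM[OF x'(1)] BM by (subst plus_emeasure) (auto intro!: arg_cong[where f="emeasure M"])
      with K(2)[OF x] have "emeasure M ?b \<le> 2 * emeasure M (?b \<inter> B)"
        by (smt (verit) add_mono add_mono_thms_linordered_semiring(1) linorder_not_le mult_2 nle_le order_refl)
      then have "ennreal D * ennreal D * emeasure M ?b \<le> ennreal D * ennreal D * (2 * emeasure M (?b \<inter> B))"
        by (intro mult_left_mono) auto
      moreover have "emeasure M (ball x (9 * (2 * r / 9 ^ K x)) \<inter> space M) \<le> ennreal D * ennreal D * emeasure M ?b"
        using rad[of "K x"] K(1)[OF x]
        by (intro D_federer_on_9[OF fed x'(2) _ ballW[OF x'(1)] W(2)]) auto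
      moreover have "emeasure M (ball x (5 * (2 * r / 9 ^ K x)) \<inter> space M) \<le> emeasure M (ball x (9 * (2 * r / 9 ^ K x)) \<inter> space M)"
        using rad(1)[of "K x"] opn by (intro emeasure_mono) auto
      ultimately show "emeasure M (ball x (5 * (2 * r / 9 ^ K x)) \<inter> space M)
         \<le> ennreal D * ennreal D * 2 * emeasure M (?b \<inter> B)"
        by (simp add: mult.assoc)
    qed (use opn BM rad in auto)
    \<comment> \<open>Outside \<open>N0\<close> at least half of the ball supplied by
      \<open>contracting_ball\<close> avoids \<open>B\<close>, so at the cost of a factor 2 the
      contraction estimate is charged to \<open>J' s a - B\<close>. The restriction
      \<open>1 \<le> k\<close> in \<open>N0\<close> matches the radii which that lemma
      returns.\<close>
    have step: "\<exists>N'. N' \<in> sets M \<and> J s a \<inter> ball x0 r \<inter> msupp M - N0 \<subseteq> N' \<and>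
       emeasure M N' \<le> (\<kappa> s * 2) * emeasure M (J' s a - B)" if s: "s \<ge> s0" and a: "a \<in> A s" for s a
    proof -
      obtain y0 where y0: "y0 \<in> ball x0 r \<inter> msupp M" "c \<le> \<bar>g a i0 y0\<bar>" using low[OF a i0(1)] by blast
      define N1 where "N1 = J s a \<inter> ball x0 r \<inter> msupp M - N0"
      have "\<exists>k::nat. 1 \<le> k \<and> ball x (2 * r / 9 ^ k) \<inter> msupp M \<subseteq> J' s a \<and>
         emeasure M (ball x (5 * (2 * r / 9 ^ k)) \<inter> J s a) \<le> \<kappa> s * emeasure M (ball x (2 * r / 9 ^ k))"
        if x: "x \<in> N1" for x
      proof -
        have le: "\<theta> s i \<le> \<theta>' s i" if "i \<in> I" for i
        proof -
          have "\<rho> ^ s * \<theta>' s i \<le> 1 * \<theta>' s i"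
            using \<rho> \<theta>(1)[OF that, of s] by (intro mult_right_mono power_le_one) auto
          with \<theta>(2)[OF that, of s] show ?thesis by simp
        qed
        have y0': "\<theta>' s i0 \<le> \<bar>g a i0 y0\<bar>" using y0(2) s0(2)[OF s] by linarith
        have x': "x \<in> ball x0 r" "x \<in> msupp M" "\<And>i. i \<in> I \<Longrightarrow> \<bar>g a i x\<bar> < \<theta> s i"
          using x by (auto simp: N1_def J_def)
        have \<rho>s: "0 < \<rho> ^ s" using \<rho> by simp
        show ?thesis
        proof (rule contracting_ball[where g = "g a" and \<theta> = "\<theta> s" and \<theta>' = "\<theta>' s" and \<rho> = "\<rho> ^ s"
              and I = I and r = r and W = W and M = M and D = D and C = C and \<alpha> = \<alpha> and ?x0.0 = x0 and x = x
              and ?i0.0 = i0 and ?y0.0 = y0])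
          show "continuous_on W (g a i)" "C_alpha_good_on C \<alpha> W M (g a i)" if "i \<in> I" for i
            using cont[OF a that] good[OF a that] by auto
          show "0 < \<theta>' s i" "\<theta> s i \<le> \<rho> ^ s * \<theta>' s i" "\<theta> s i \<le> \<theta>' s i" if "i \<in> I" for i
            using \<theta> le that by auto
          fix k :: nat
          assume "1 \<le> k" "ball x (2 * r / 9 ^ k) \<inter> msupp M \<subseteq> {y \<in> W. \<forall>i\<in>I. \<bar>g a i y\<bar> < \<theta>' s i}"
            "emeasure M (ball x (5 * (2 * r / 9 ^ k)) \<inter> {y \<in> W. \<forall>i\<in>I. \<bar>g a i y\<bar> < \<theta> s i})
             \<le> ennreal C * ennreal ((\<rho> ^ s) powr \<alpha>) * (ennreal D * ennreal D) * emeasure M (ball x (2 * r / 9 ^ k))"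
          then show ?thesis unfolding J_def J'_def \<kappa>_def by blast
        qed fact+
      qed
      then obtain L where L: "\<And>x. x \<in> N1 \<Longrightarrow> 1 \<le> (L x :: nat)"
         "\<And>x. x \<in> N1 \<Longrightarrow> ball x (2 * r / 9 ^ L x) \<inter> msupp M \<subseteq> J' s a"
         "\<And>x. x \<in> N1 \<Longrightarrow> emeasure M (ball x (5 * (2 * r / 9 ^ L x)) \<inter> J s a) \<le> \<kappa> s * emeasure M (ball x (2 * r / 9 ^ L x))"
        by metis
      obtain N' where N': "N' \<in> sets M" "N1 \<inter> J s a \<subseteq> N'" "emeasure M N' \<le> (\<kappa> s * 2) * emeasure M (J' s a - B)"
      proof (rule Vitali_emeasure_bound[of M "J' s a - B" "J s a" N1 "\<lambda>x. 2 * r / 9 ^ L x" "2 * r" "\<kappa> s * 2"])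
        fix x assume x: "x \<in> N1"
        let ?b = "ball x (2 * r / 9 ^ L x)"
        have x': "x \<in> ball x0 r" "x \<in> msupp M" "x \<notin> N0" using x by (auto simp: N1_def)
        have "emeasure M ?b \<le> 2 * emeasure M (?b - B)"
          using x' L(1)[OF x] by (auto simp: N0_def not_less)
        \<comment> \<open>The ball is inside \<open>J' s a\<close> only on the support, hence the
          inclusion is used almost everywhere.\<close>
        also have "emeasure M (?b - B) \<le> emeasure M (?b \<inter> (J' s a - B))"
          using supp L(2)[OF x] J'M[OF a] BM ballM[OF x'(1)]
          by (intro emeasure_mono_AE) (auto elim!: eventually_mono)
        finally have "emeasure M ?b \<le> 2 * emeasure M (?b \<inter> (J' s a - B))" by (simp add: mult_left_mono)
        then have "\<kappa> s * emeasure M ?b \<le> \<kappa> s * (2 * emeasure M (?b \<inter> (J' s a - B)))"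
          by (intro mult_left_mono) auto
        with L(3)[OF x] show "emeasure M (ball x (5 * (2 * r / 9 ^ L x)) \<inter> J s a) \<le> \<kappa> s * 2 * emeasure M (?b \<inter> (J' s a - B))"
          by (simp add: mult.assoc)
      qed (use opn BM J'M[OF a] JM[OF a] rad in auto)
      then show ?thesis by (intro exI[of _ N']) (auto simp: N1_def)
    qed
    define N2 where "N2 s a = (SOME N'. N' \<in> sets M \<and> J s a \<inter> ball x0 r \<inter> msupp M - N0 \<subseteq> N' \<and>
       emeasure M N' \<le> (\<kappa> s * 2) * emeasure M (J' s a - B))" for s a
    have N2: "N2 s a \<in> sets M" "J s a \<inter> ball x0 r \<inter> msupp M - N0 \<subseteq> N2 s a"
       "emeasure M (N2 s a) \<le> (\<kappa> s * 2) * emeasure M (J' s a - B)" if "s \<ge> s0" "a \<in> A s" for s a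
      using someI_ex[OF step[OF that], folded N2_def] by auto
    define N3 where "N3 s = (if s \<ge> s0 then (\<Union>a\<in>A s. N2 s a) else {})" for s
    have N3M: "N3 s \<in> sets M" for s
      unfolding N3_def using A N2(1) by (auto intro!: sets.countable_UN'')
    define Q where "Q = 2 * max 0 C * (max 0 D * max 0 D) * measure M W"
    have N3: "emeasure M (N3 s) \<le> ennreal (Q * (\<rho> powr \<alpha>) ^ s)" for s
    proof (cases "s \<ge> s0")
      case True
      have "emeasure M (\<Union>a\<in>A s. N2 s a) \<le> (\<kappa> s * 2) * emeasure M W"
      \<comment> \<open>Two relaxed sets at a scale \<open>s \<ge> s0\<close> meet only inside
        \<open>H s\<close>, which is part of \<open>B\<close>; removing \<open>B\<close> makes them
        disjoint.\<close>
      proof (rule emeasure_UN_le_cmult_disjoint[where Q = "\<lambda>a. J' s a - B"])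
        show "disjoint_family_on (\<lambda>a. J' s a - B) (A s)"
          unfolding disjoint_family_on_def B_def T_def H_def using True by fastforce
      qed (use A N2 True J'M BM WM in \<open>auto simp: J'_def\<close>)
      also have "\<dots> = (\<kappa> s * 2) * ennreal (measure M W)"
        using fin by (simp add: emeasure_eq_ennreal_measure)
      also have "\<dots> = ennreal (Q * (\<rho> powr \<alpha>) ^ s)"
      proof -
        have "(\<rho> ^ s) powr \<alpha> = (\<rho> powr \<alpha>) ^ s"
          using \<rho> by (simp add: powr_realpow[symmetric] powr_powr mult.commute)
        moreover have "ennreal C = ennreal (max 0 C)" "ennreal D = ennreal (max 0 D)"
          by (auto simp: max_def ennreal_neg)
        moreover have "(2::ennreal) = ennreal 2" by simp
        ultimately show ?thesis
          unfolding \<kappa>_def Q_def by (simp only: ennreal_mult[symmetric] ennreal_mult'[symmetric] max.cobounded1 measure_nonneg zero_le_power powr_ge_zero mult_nonneg_nonneg zero_le_numeral ac_simps)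
      qed
      finally show ?thesis using True by (simp add: N3_def)
    qed (auto simp: N3_def)
    have Q0: "0 \<le> Q" by (simp add: Q_def)
    have "AE x in M. \<forall>\<^sub>F s in sequentially. x \<in> space M - N3 s"
    proof (rule borel_cantelli_AE1)
      show "emeasure M (N3 s) < \<infinity>" for s using N3[of s] by (simp add: le_less_trans)
      show "summable (\<lambda>s. measure M (N3 s))"
      proof (rule summable_comparison_test')
        have "\<rho> powr \<alpha> < 1" using powr_less_mono2[of \<alpha> \<rho> 1] \<rho> \<open>0 < \<alpha>\<close> by simp
        then show "summable (\<lambda>s. Q * (\<rho> powr \<alpha>) ^ s)"
          by (intro summable_mult summable_geometric) auto
        show "norm (measure M (N3 s)) \<le> Q * (\<rho> powr \<alpha>) ^ s" if "0 \<le> s" for s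
          using N3[of s] Q0 by (simp add: measure_def enn2real_leI)
      qed
    qed (rule N3M)
    then have "AE x in M. x \<in> ball x0 r \<longrightarrow> x \<in> N \<or>
       (\<forall>\<^sub>F s in sequentially. \<forall>a\<in>A s. \<not> (\<forall>i\<in>I. \<bar>g a i x\<bar> < \<theta> s i))"
      using supp AE_space
    proof eventually_elim
      case (elim x)
      show ?case
      proof (intro impI disjCI)
        assume x: "x \<in> ball x0 r"
        assume "\<not> (\<forall>\<^sub>F s in sequentially. \<forall>a\<in>A s. \<not> (\<forall>i\<in>I. \<bar>g a i x\<bar> < \<theta> s i))"
        then have "\<exists>\<^sub>F s in sequentially. \<exists>a\<in>A s. \<forall>i\<in>I. \<bar>g a i x\<bar> < \<theta> s i"
          by (simp add: frequently_def)
        from frequently_eventually_frequently[OF this eventually_conj[OF elim(1) eventually_ge_at_top[of s0]]]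
        obtain s a where *: "a \<in> A s" "\<forall>i\<in>I. \<bar>g a i x\<bar> < \<theta> s i" "x \<notin> N3 s" "s \<ge> s0"
          by (auto dest!: frequently_ex)
        then have "x \<in> J s a" using ballW[OF x, of "2 * r"] rad[of 0] by (auto simp: J_def)
        then have "x \<in> N0" using N2(2)[OF *(4,1)] * x elim by (auto simp: N3_def)
        with N elim show "x \<in> N" by blast
      qed
    qed
    moreover have "emeasure M N \<le> ennreal (2 * (max 0 D * max 0 D) * \<delta>)"
    proof -
      have "emeasure M N \<le> (ennreal D * ennreal D * 2) * ennreal \<delta>"
        using N(3) s0(1) unfolding B_def by (meson less_imp_le mult_left_mono order_trans zero_le)
      also have "\<dots> = ennreal (2 * (max 0 D * max 0 D) * \<delta>)"
      proof -
        have "ennreal D = ennreal (max 0 D)" by (auto simp: max_def ennreal_neg)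
        moreover have "(2::ennreal) = ennreal 2" by simp
        ultimately show ?thesis
          using \<open>0 < \<delta>\<close> by (simp only: ennreal_mult[symmetric] ennreal_mult'[symmetric] max.cobounded1 less_imp_le mult_nonneg_nonneg zero_le_numeral ac_simps)
      qed
      finally show ?thesis .
    qed
    ultimately show ?thesis using N by blast
  qed
  \<comment> \<open>The exceptional sets for \<open>\<delta> n\<close> have measures tending to 0,
    so their intersection is null, and off it the conclusion holds for some
    \<open>n\<close>.\<close>
  define \<delta> where "\<delta> n = 1 / real (Suc n)" for n
  have "\<forall>n. \<exists>N\<in>sets M. emeasure M N \<le> ennreal (2 * (max 0 D * max 0 D) * \<delta> n) \<and>
    (AE x in M. x \<in> ball x0 r \<longrightarrow> x \<in> N \<or>
       (\<forall>\<^sub>F s in sequentially. \<forall>a\<in>A s. \<not> (\<forall>i\<in>I. \<bar>g a i x\<bar> < \<theta> s i)))"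
    by (intro allI main) (simp add: \<delta>_def)
  from choice[OF this[unfolded Bex_def]] obtain N where N:
    "N n \<in> sets M" "emeasure M (N n) \<le> ennreal (2 * (max 0 D * max 0 D) * \<delta> n)"
    "AE x in M. x \<in> ball x0 r \<longrightarrow> x \<in> N n \<or>
       (\<forall>\<^sub>F s in sequentially. \<forall>a\<in>A s. \<not> (\<forall>i\<in>I. \<bar>g a i x\<bar> < \<theta> s i))" for n
    by blast
  have "emeasure M (\<Inter>n. N n) \<le> 0"
  proof (rule tendsto_lowerbound)
    show "(\<lambda>n. ennreal (2 * (max 0 D * max 0 D) * \<delta> n)) \<longlonglongrightarrow> 0"
      unfolding \<delta>_def ennreal_0[symmetric]
      by (intro tendsto_ennrealI tendsto_mult_right_zero LIMSEQ_Suc lim_1_over_n)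
    show "\<forall>\<^sub>F n in sequentially. emeasure M (\<Inter>n. N n) \<le> ennreal (2 * (max 0 D * max 0 D) * \<delta> n)"
      by (intro always_eventually allI order_trans[OF emeasure_mono N(2)]) (use N(1) in auto)
  qed auto
  then have "(\<Inter>n. N n) \<in> null_sets M" using N(1) by (intro null_setsI) auto
  then have "AE x in M. x \<notin> (\<Inter>n. N n)" by (rule AE_not_in)
  moreover have "AE x in M. \<forall>n. x \<in> ball x0 r \<longrightarrow> x \<in> N n \<or>
       (\<forall>\<^sub>F s in sequentially. \<forall>a\<in>A s. \<not> (\<forall>i\<in>I. \<bar>g a i x\<bar> < \<theta> s i))"
    using N(3) by (subst AE_all_countable) auto
  ultimately show ?thesis by eventually_elim blast
qed

section \<open>Transference for affine forms\<close>

text \<open>Compactness of the unit sphere of coefficients \<open>(a, b)\<close>: no such form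
  vanishes on the whole support in the ball, by non-planarity if \<open>a \<noteq> 0\<close> and
  because \<open>b \<noteq> 0\<close> otherwise. Homogeneity extends the bound to all forms of norm
  at least 1, in particular to every nonzero integer \<open>a\<close> with any constant
  term.\<close>

lemma nonplanar_lower_bound:
  fixes f :: "'a::euclidean_space \<Rightarrow> real ^ 'n"
  assumes "nonplanar_pair U f \<mu>" "x0 \<in> msupp \<mu>" "0 < r" "ball x0 r \<subseteq> U"
  obtains c where "0 < c"
    "\<And>a b. 1 \<le> norm a \<Longrightarrow> \<exists>y \<in> ball x0 r \<inter> msupp \<mu>. c \<le> \<bar>b + a \<bullet> f y\<bar>"
proof -
  define S where "S = ball x0 r \<inter> msupp \<mu>"
  have x0: "x0 \<in> S" using assms by (auto simp: S_def)
  \<comment> \<open>Openness is in the coefficients with the point \<open>y\<close> fixed; the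
    second index records the threshold, so a finite subcover has a smallest one.\<close>
  define O' where "O' = (\<lambda>(y, k::nat). {v :: (real ^ 'n) \<times> real. 1 / real (Suc k) < \<bar>snd v + fst v \<bullet> f y\<bar>})"
  have "open (O' t)" for t
    unfolding O'_def by (cases t) (auto intro!: open_Collect_less continuous_intros)
  moreover have "sphere 0 1 \<subseteq> (\<Union>t\<in>S \<times> UNIV. O' t)"
  proof
    fix v :: "(real ^ 'n) \<times> real" assume v: "v \<in> sphere 0 1"
    obtain a b where ab: "v = (a, b)" by (cases v)
    have "\<exists>y\<in>S. b + a \<bullet> f y \<noteq> 0"
    proof (cases "a = 0")
      case True
      with v ab x0 show ?thesis by (auto simp: norm_Pair)
    next
      case False
      have "\<not> f ` S \<subseteq> {y. a \<bullet> y = - b}"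
        using assms False unfolding nonplanar_pair_def S_def by blast
      then show ?thesis by force
    qed
    then obtain y where y: "y \<in> S" "0 < \<bar>b + a \<bullet> f y\<bar>" by auto
    then obtain k where "1 / real (Suc k) < \<bar>b + a \<bullet> f y\<bar>"
      using reals_Archimedean[of "\<bar>b + a \<bullet> f y\<bar>"] by (auto simp: inverse_eq_divide)
    with y ab have "v \<in> O' (y, k)" "(y, k) \<in> S \<times> UNIV" by (auto simp: O'_def)
    then show "v \<in> (\<Union>t\<in>S \<times> UNIV. O' t)" by blast
  qed
  ultimately obtain C where C: "C \<subseteq> S \<times> UNIV" "finite C" "sphere 0 1 \<subseteq> (\<Union>t\<in>C. O' t)"
    by (rule compactE_image[OF compact_sphere])
  obtain n where n: "\<And>k. k \<in> snd ` C \<Longrightarrow> k \<le> n"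
    using C(2) finite_nat_set_iff_bounded_le[of "snd ` C"] by auto
  show ?thesis
  proof (rule that[of "1 / real (Suc n)"])
    fix a :: "real ^ 'n" and b :: real
    assume a: "1 \<le> norm a"
    define N where "N = norm (a, b)"
    have N: "1 \<le> N" using a norm_fst_le[of a b] by (simp add: N_def)
    have "(a /\<^sub>R N, b / N) = (a, b) /\<^sub>R N" by (simp add: divide_inverse mult.commute)
    moreover have "norm ((a, b) /\<^sub>R N) = \<bar>inverse N\<bar> * N" by (simp only: norm_scaleR N_def[symmetric])
    moreover have "\<bar>inverse N\<bar> * N = 1" using N by simp
    ultimately have "norm (a /\<^sub>R N, b / N) = 1" by simp
    then have "(a /\<^sub>R N, b / N) \<in> sphere 0 1" by simp
    then obtain y k where yk: "(y, k) \<in> C" "(a /\<^sub>R N, b / N) \<in> O' (y, k)" using C(3) by fast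
    have "1 / real (Suc n) \<le> 1 / real (Suc k)"
      using n[of k] yk(1) by (auto intro!: divide_left_mono simp: rev_image_eqI)
    also have "\<dots> \<le> \<bar>b / N + (a /\<^sub>R N) \<bullet> f y\<bar>" using yk(2) by (auto simp: O'_def)
    also have "b / N + (a /\<^sub>R N) \<bullet> f y = (b + a \<bullet> f y) / N" by (simp add: field_simps add_divide_distrib)
    also have "\<bar>(b + a \<bullet> f y) / N\<bar> \<le> \<bar>b + a \<bullet> f y\<bar>"
      using N mult_right_mono[of 1 N "\<bar>b + a \<bullet> f y\<bar>"] by (simp add: abs_divide divide_le_eq mult.commute)
    finally show "\<exists>y\<in>ball x0 r \<inter> msupp \<mu>. 1 / real (Suc n) \<le> \<bar>b + a \<bullet> f y\<bar>"
      using yk(1) C(1) by (auto simp: S_def)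
  qed auto
qed

text \<open>Needed to give all rows common constants. Lowering the exponent enlarges the bound if
  the quotient is at most 1; otherwise the bound is at least the measure of the ball, thanks to
  \<open>1 \<le> C'\<close>.\<close>

lemma C_alpha_good_on_mono:
  assumes "C_alpha_good_on C \<alpha> W M f" "V \<subseteq> W" "open V" "V \<subseteq> space M"
    and opn: "\<And>V. open V \<Longrightarrow> V \<inter> space M \<in> sets M"
    and "C \<le> C'" "1 \<le> C'" "0 < \<alpha>'" "\<alpha>' \<le> \<alpha>"
  shows "C_alpha_good_on C' \<alpha>' V M f"
  unfolding C_alpha_good_on_def
proof (intro ballI allI impI)
  fix r \<epsilon> :: real and x0 assume x: "x0 \<in> msupp M" "0 < r" "0 < \<epsilon>" "ball x0 r \<subseteq> V"
  define t where "t = ennreal \<epsilon> / sup_norm_on M (ball x0 r) f"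
  show "emeasure M {y \<in> ball x0 r. \<bar>f y\<bar> < \<epsilon>} \<le> ennreal C' * epowr t \<alpha>' * emeasure M (ball x0 r)"
  proof (cases "t \<le> 1")
    case True
    then obtain u where u: "t = ennreal u" "0 \<le> u" "u \<le> 1" by (cases t) (auto simp: top_unique)
    have "u powr \<alpha> \<le> u powr \<alpha>'" using u assms by (intro powr_mono') auto
    then have "epowr t \<alpha> \<le> epowr t \<alpha>'" using u by (auto simp: epowr_def intro: ennreal_leI)
    have "emeasure M {y \<in> ball x0 r. \<bar>f y\<bar> < \<epsilon>} \<le> ennreal C * epowr t \<alpha> * emeasure M (ball x0 r)"
      using assms(1,2) x unfolding C_alpha_good_on_def t_def by simp
    also have "\<dots> \<le> ennreal C' * epowr t \<alpha>' * emeasure M (ball x0 r)"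
      using \<open>epowr t \<alpha> \<le> epowr t \<alpha>'\<close> \<open>C \<le> C'\<close> by (intro mult_mono ennreal_leI) auto
    finally show ?thesis .
  next
    case False
    have "1 \<le> epowr t \<alpha>'"
    proof (cases "t = \<infinity>")
      case False
      then obtain u where u: "t = ennreal u" "0 \<le> u" by (cases t) auto
      with \<open>\<not> t \<le> 1\<close> have "1 \<le> u" by (metis ennreal_1 ennreal_leI linear)
      then have "1 \<le> u powr \<alpha>'" using \<open>0 < \<alpha>'\<close> by (simp add: ge_one_powr_ge_zero)
      then show ?thesis using u by (simp add: epowr_def)
    qed (auto simp: epowr_def)
    have "ball x0 r \<in> sets M"
      using opn[of "ball x0 r"] x(4) assms(4) by (simp add: Int_absorb2)
    then have "emeasure M {y \<in> ball x0 r. \<bar>f y\<bar> < \<epsilon>} \<le> 1 * 1 * emeasure M (ball x0 r)"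
      by (auto intro: emeasure_mono)
    also have "\<dots> \<le> ennreal C' * epowr t \<alpha>' * emeasure M (ball x0 r)"
      using \<open>1 \<le> epowr t \<alpha>'\<close> \<open>1 \<le> C'\<close> ennreal_leI[of 1 C'] by (intro mult_mono) auto
    finally show ?thesis .
  qed
qed

lemma countable_int_vecs: "countable (int_vecs :: (real ^ 'k) set)"
proof -
  have "int_vecs \<subseteq> range (\<lambda>f :: 'k \<Rightarrow> int. \<chi> i. real_of_int (f i))"
  proof
    fix v :: "real ^ 'k" assume "v \<in> int_vecs"
    then have "v = (\<chi> i. real_of_int \<lfloor>v $ i\<rfloor>)" by (simp add: vec_eq_iff int_vecs_def)
    then show "v \<in> range (\<lambda>f :: 'k \<Rightarrow> int. \<chi> i. real_of_int (f i))" by (rule range_eqI[of _ _ "\<lambda>i. \<lfloor>v $ i\<rfloor>"])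
  qed
  then show ?thesis by (rule countable_subset) auto
qed

lemma norm_int_vec_ge_1:
  assumes "q \<in> int_vecs" "q \<noteq> (0 :: real ^ 'k)"
  shows "1 \<le> norm q"
proof -
  obtain i where "q $ i \<noteq> 0" using assms(2) by (auto simp: vec_eq_iff)
  then have "1 \<le> \<bar>q $ i\<bar>" using assms(1) by (auto simp: int_vecs_def intro: Ints_nonzero_abs_ge1)
  then show ?thesis using component_le_norm_cart[of q i] by linarith
qed

text \<open>\<open>local_transference\<close> on a small ball about almost every point, with
  constants common to all rows. \<open>S\<close> is the set of rows in which smallness is demanded;
  the multiplicative case leaves some rows out.\<close>

lemma transference:
  fixes U :: "(real ^ 'd) set" and \<mu> :: "(real ^ 'd) measure"
    and F :: "real ^ 'd \<Rightarrow> real ^ 'n ^ 'm" and z :: "real ^ 'm"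
    and A :: "nat \<Rightarrow> ((real ^ 'n) \<times> (real ^ 'm)) set"
  assumes "open U" and radon: "radon_measure_on U \<mu>" and fed: "federer_on U \<mu>" and cont: "continuous_on U F"
    and good: "\<And>j. good_pair U (\<lambda>x. row j (F x)) \<mu>"
    and nonpl: "\<And>j. nonplanar_pair U (\<lambda>x. row j (F x)) \<mu>"
    and A: "\<And>s. A s \<subseteq> (int_vecs - {0}) \<times> int_vecs"
    and \<theta>: "\<And>s i. i \<in> S \<Longrightarrow> 0 < \<theta>' s i" "\<And>s i. i \<in> S \<Longrightarrow> \<theta> s i \<le> \<rho> ^ s * \<theta>' s i"
    and \<rho>: "0 < \<rho>" "\<rho> < 1" and i0: "i0 \<in> S" "(\<lambda>s. \<theta>' s i0) \<longlonglongrightarrow> 0"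
    and uniq: "AE x in \<mu>. \<forall>\<^sub>F s in sequentially. \<forall>a\<in>A s. \<forall>b\<in>A s.
      (\<forall>i\<in>S. \<bar>(F x *v fst a + z - snd a) $ i\<bar> < \<theta>' s i) \<and>
      (\<forall>i\<in>S. \<bar>(F x *v fst b + z - snd b) $ i\<bar> < \<theta>' s i) \<longrightarrow> a = b"
  shows "AE x in \<mu>. \<forall>\<^sub>F s in sequentially. \<forall>a\<in>A s.
      \<not> (\<forall>i\<in>S. \<bar>(F x *v fst a + z - snd a) $ i\<bar> < \<theta> s i)"
proof (rule AE_locally)
  have sets: "sets \<mu> = sets (restrict_space borel U)" using radon by (simp add: radon_measure_on_def)
  then have space: "space \<mu> = U" using sets_eq_imp_space_eq[OF sets] by (simp add: space_restrict_space)
  have opn: "V \<inter> space \<mu> \<in> sets \<mu>" if "open V" for V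
    using that unfolding sets space by (auto simp: sets_restrict_space)
  have supp: "AE x in \<mu>. x \<in> msupp \<mu>" by (rule AE_msupp) (rule opn)
  have good': "AE x in \<mu>. \<forall>j\<in>UNIV. \<exists>W. open W \<and> x \<in> W \<and> W \<subseteq> U \<and>
      (\<exists>C>0. \<exists>\<alpha>>0. \<forall>c0. \<forall>c :: real ^ 'n.
        C_alpha_good_on C \<alpha> W \<mu> (\<lambda>y. c0 + (\<Sum>i\<in>UNIV. c $ i * row j (F y) $ i)))"
    using good unfolding good_pair_def by (intro AE_finite_allI) auto
  from fed[unfolded federer_on_def] good' supp
  show "AE x in \<mu>. (\<forall>\<^sub>F s in sequentially. \<forall>a\<in>A s.
      \<not> (\<forall>i\<in>S. \<bar>(F x *v fst a + z - snd a) $ i\<bar> < \<theta> s i)) \<or>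
      (\<exists>V. open V \<and> x \<in> V \<and> (AE y in \<mu>. y \<in> V \<longrightarrow> (\<forall>\<^sub>F s in sequentially. \<forall>a\<in>A s.
      \<not> (\<forall>i\<in>S. \<bar>(F y *v fst a + z - snd a) $ i\<bar> < \<theta> s i))))"
  proof eventually_elim
    case (elim x0)
    then obtain W0 D where W0: "open W0" "x0 \<in> W0" "W0 \<subseteq> U" "D_federer_on D W0 \<mu>" by blast
    define G where "G j t \<longleftrightarrow> open (fst t) \<and> x0 \<in> fst t \<and> fst t \<subseteq> U \<and> 0 < fst (snd t) \<and> 0 < snd (snd t) \<and>
      (\<forall>c0. \<forall>c. C_alpha_good_on (fst (snd t)) (snd (snd t)) (fst t) \<mu>
        (\<lambda>y. c0 + (\<Sum>i\<in>UNIV. c $ i * row j (F y) $ i)))" for j t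
    have "\<exists>t. G j t" for j
      using bspec[OF elim(2) UNIV_I[of j]]
    proof (elim exE conjE)
      fix W C \<alpha> assume "open W" "x0 \<in> W" "W \<subseteq> U" "0 < C" "0 < \<alpha>"
        "\<forall>c0. \<forall>c. C_alpha_good_on C \<alpha> W \<mu> (\<lambda>y. c0 + (\<Sum>i\<in>UNIV. c $ i * row j (F y) $ i))"
      then show "\<exists>t. G j t" unfolding G_def by (intro exI[of _ "(W, C, \<alpha>)"]) simp
    qed
    then obtain T where T: "G j (T j)" for j by metis
    define W C \<alpha> where "W j = fst (T j)" and "C j = fst (snd (T j))" and "\<alpha> j = snd (snd (T j))" for j
    have W: "open (W j)" "x0 \<in> W j" "W j \<subseteq> U" "0 < C j" "0 < \<alpha> j"
      "C_alpha_good_on (C j) (\<alpha> j) (W j) \<mu> (\<lambda>y. c0 + (\<Sum>i\<in>UNIV. c $ i * row j (F y) $ i))" for j c0 c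
      using T[of j] unfolding G_def W_def C_def \<alpha>_def by blast+
    have "open (W0 \<inter> (\<Inter>j. W j))" "x0 \<in> W0 \<inter> (\<Inter>j. W j)" using W0 W by (auto intro!: open_INT)
    \<comment> \<open>A closed ball, since its compactness makes the mass of \<open>V\<close> finite
      by the Radon property. The conclusion will hold on the concentric ball of a third of the
      radius.\<close>
    then obtain R where R: "0 < R" "cball x0 R \<subseteq> W0 \<inter> (\<Inter>j. W j)" by (meson open_contains_cball)
    define r where "r = R / 3"
    have r: "0 < r" "R = 3 * r" using R by (auto simp: r_def)
    define V where "V = ball x0 (3 * r)"
    have VR: "V \<subseteq> cball x0 R" by (auto simp: V_def r)
    have V: "V \<subseteq> W0" "\<And>j. V \<subseteq> W j" "V \<subseteq> U" using VR R W0 by auto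
    have fin: "emeasure \<mu> V < \<infinity>"
    proof -
      have "cball x0 R \<subseteq> U" using R W0 by auto
      then have "emeasure \<mu> (cball x0 R) < \<infinity>" using radon by (auto simp: radon_measure_on_def)
      moreover have "cball x0 R \<in> sets \<mu>"
        unfolding sets using \<open>cball x0 R \<subseteq> U\<close> \<open>open U\<close> by (subst sets_restrict_space_iff) auto
      ultimately show ?thesis using emeasure_mono[OF VR, of \<mu>] by (simp add: le_less_trans)
    qed
    have x0: "x0 \<in> msupp \<mu>" by fact
    have "\<exists>c>0. \<forall>a b. 1 \<le> norm a \<longrightarrow> (\<exists>y \<in> ball x0 r \<inter> msupp \<mu>. c \<le> \<bar>b + a \<bullet> row j (F y)\<bar>)" for j
    proof -
      have "ball x0 r \<subseteq> V" unfolding V_def using r(1) by (intro subset_ball) simp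
      with V(3) have "ball x0 r \<subseteq> U" by blast
      from nonplanar_lower_bound[OF nonpl[of j] x0 r(1) this] show ?thesis by metis
    qed
    then obtain c where c: "\<And>j. 0 < c j"
      "\<And>j a b. 1 \<le> norm a \<Longrightarrow> \<exists>y \<in> ball x0 r \<inter> msupp \<mu>. c j \<le> \<bar>b + a \<bullet> row j (F y)\<bar>"
      by metis
    \<comment> \<open>The same affine form twice: the inner product suits the lower bound from
      non-planarity, the sum suits goodness.\<close>
    have form: "(F y *v q + z - p) $ i = (z $ i - p $ i) + q \<bullet> row i (F y)"
      "(F y *v q + z - p) $ i = (z $ i - p $ i) + (\<Sum>j\<in>UNIV. q $ j * row i (F y) $ j)" for y q p i
      by (simp_all add: matrix_vector_mult_def row_def inner_vec_def mult.commute)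
    define C' where "C' = 1 + (\<Sum>j\<in>UNIV. C j)"
    have C': "C j \<le> C'" "1 \<le> C'" for j
      using member_le_sum[of j UNIV C] W(4) sum_nonneg[of UNIV C] by (auto simp: C'_def less_imp_le add_increasing)
    define \<alpha>' where "\<alpha>' = Min (range \<alpha>)"
    have \<alpha>': "0 < \<alpha>'" "\<alpha>' \<le> \<alpha> j" for j using W(5) by (auto simp: \<alpha>'_def)
    define c' where "c' = Min (range c)"
    have c': "0 < c'" "c' \<le> c j" for j using c(1) by (auto simp: c'_def)
    have "AE x in \<mu>. x \<in> ball x0 r \<longrightarrow> (\<forall>\<^sub>F s in sequentially. \<forall>a\<in>A s.
      \<not> (\<forall>i\<in>S. \<bar>(F x *v fst a + z - snd a) $ i\<bar> < \<theta> s i))"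
    proof (rule local_transference[where g = "\<lambda>a i y. (F y *v fst a + z - snd a) $ i"
          and W = V and D = D and C = C' and \<alpha> = \<alpha>' and c = c' and \<rho> = \<rho> and \<theta>' = \<theta>'])
      show "D_federer_on D V \<mu>" using W0(4) V(1) unfolding D_federer_on_def by blast
      show "continuous_on V (\<lambda>y. (F y *v fst a + z - snd a) $ i)" for a :: "(real ^ 'n) \<times> (real ^ 'm)" and i
        unfolding matrix_vector_mult_def
        by (auto intro!: continuous_intros continuous_on_subset[OF cont V(3)])
      show "C_alpha_good_on C' \<alpha>' V \<mu> (\<lambda>y. (F y *v fst a + z - snd a) $ i)" for a :: "(real ^ 'n) \<times> (real ^ 'm)" and i
        unfolding form(2)
        by (rule C_alpha_good_on_mono[OF W(6)]) (use V C' \<alpha>' opn space in \<open>auto simp: V_def\<close>)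
      show "countable (A s)" for s
        by (rule countable_subset[OF A]) (auto intro!: countable_SIGMA countable_Diff countable_int_vecs)
      show "\<exists>y\<in>ball x0 r \<inter> msupp \<mu>. c' \<le> \<bar>(F y *v fst a + z - snd a) $ i\<bar>" if "a \<in> A s" for a s i
      proof -
        have "1 \<le> norm (fst a)" using A[of s] that by (intro norm_int_vec_ge_1) auto
        from c(2)[OF this, where j=i and b = "z $ i - snd a $ i"] c'(2)[of i] show ?thesis
          unfolding form(1) by force
      qed
      show "AE x in \<mu>. x \<in> V \<longrightarrow> (\<forall>\<^sub>F s in sequentially. \<forall>a\<in>A s. \<forall>b\<in>A s.
        (\<forall>i\<in>S. \<bar>(F x *v fst a + z - snd a) $ i\<bar> < \<theta>' s i) \<and>
        (\<forall>i\<in>S. \<bar>(F x *v fst b + z - snd b) $ i\<bar> < \<theta>' s i) \<longrightarrow> a = b)"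
        using uniq by eventually_elim blast
      show "V \<subseteq> space \<mu>" using V(3) space by simp
      show "i0 \<in> S" "(\<lambda>s. \<theta>' s i0) \<longlonglongrightarrow> 0" "finite S" "emeasure \<mu> V < \<infinity>" "0 < \<alpha>'" "0 < c'"
        using i0 fin \<alpha>'(1) c'(1) by simp_all
    qed (rule V_def opn r(1) \<theta> \<rho>; assumption?)+
    with r(1) show ?case by (intro disjI2 exI[of _ "ball x0 r"] conjI open_ball) (simp_all only: centre_in_ball)
  qed
qed

section \<open>Approximability at a fixed exponent\<close>

text \<open>Common shape of both notions, with \<open>h\<close> the size of the error and
  \<open>b\<close> the size of \<open>q\<close>. The exponent is kept fixed so that
  \<open>\<epsilon>\<close> can later run through the countable family
  \<open>1 / real (Suc k)\<close>, which is needed both for null sets and for measurability.\<close>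

definition approximable ::
  "(real ^ 'm \<Rightarrow> real) \<Rightarrow> (real ^ 'n \<Rightarrow> real) \<Rightarrow> real \<Rightarrow> real ^ 'n ^ 'm \<Rightarrow> real ^ 'm \<Rightarrow> bool" where
  "approximable h b \<epsilon> Y z \<longleftrightarrow> (\<forall>Q0. \<exists>Q>Q0. Q > 1 \<and>
      (\<exists>q\<in>int_vecs - {0}. \<exists>p\<in>int_vecs. h (Y *v q + z - p) < Q powr (- 1 - \<epsilon>) \<and> b q \<le> Q))"

lemma VWA_iff_approximable:
  "VWA (Y :: real ^ 'n ^ 'm) z \<longleftrightarrow> (\<exists>\<epsilon>>0. approximable (\<lambda>w. norm w ^ CARD('m)) (\<lambda>q. norm q ^ CARD('n)) \<epsilon> Y z)"
  unfolding VWA_def approximable_def ..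

lemma VWMA_iff_approximable:
  "VWMA Y z \<longleftrightarrow> (\<exists>\<epsilon>>0. approximable coord_prod coord_prod_plus \<epsilon> Y z)"
  unfolding VWMA_def approximable_def ..

lemma approximable_antimono:
  assumes "approximable h b \<epsilon> Y z" "\<epsilon>' \<le> \<epsilon>"
  shows "approximable h b \<epsilon>' Y z"
  unfolding approximable_def
proof
  fix Q0
  from assms(1) obtain Q q p where *: "Q > Q0" "Q > 1" "q \<in> int_vecs - {0}" "p \<in> int_vecs"
    "h (Y *v q + z - p) < Q powr (- 1 - \<epsilon>)" "b q \<le> Q"
    unfolding approximable_def by metis
  have "Q powr (- 1 - \<epsilon>) \<le> Q powr (- 1 - \<epsilon>')" using * assms(2) by (intro powr_mono) auto
  with * show "\<exists>Q>Q0. Q > 1 \<and> (\<exists>q\<in>int_vecs - {0}. \<exists>p\<in>int_vecs.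
    h (Y *v q + z - p) < Q powr (- 1 - \<epsilon>') \<and> b q \<le> Q)"
    by (meson less_le_trans)
qed

lemma ex_approximable_iff:
  "(\<exists>\<epsilon>>0. approximable h b \<epsilon> Y z) \<longleftrightarrow> (\<exists>k. approximable h b (1 / real (Suc k)) Y z)"
proof
  assume "\<exists>\<epsilon>>0. approximable h b \<epsilon> Y z"
  then obtain \<epsilon> k where "approximable h b \<epsilon> Y z" "1 / real (Suc k) < \<epsilon>"
    using nat_approx_posE by metis
  then show "\<exists>k. approximable h b (1 / real (Suc k)) Y z"
    using approximable_antimono less_imp_le by blast
next
  assume "\<exists>k. approximable h b (1 / real (Suc k)) Y z"
  then obtain k where "approximable h b (1 / real (Suc k)) Y z" by blast
  moreover have "0 < 1 / real (Suc k)" by simp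
  ultimately show "\<exists>\<epsilon>>0. approximable h b \<epsilon> Y z" by blast
qed

text \<open>For fixed \<open>k\<close> and \<open>N\<close> the union over all real \<open>Q\<close>
  is uncountable but open, so a countable union of countable intersections of open sets remains. It
  allows almost-everywhere statements to pass through \<open>distr\<close>.\<close>

lemma sets_approximable:
  fixes h :: "real ^ 'm \<Rightarrow> real" and b :: "real ^ 'n \<Rightarrow> real"
  assumes h: "continuous_on UNIV h"
  shows "{Y. \<exists>\<epsilon>>0. approximable h b \<epsilon> Y z} \<in> sets borel"
proof -
  define B where "B k N = (\<Union>Q\<in>{Q. real N < Q \<and> 1 < Q}. \<Union>q\<in>{q \<in> int_vecs - {0}. b q \<le> Q}. \<Union>p\<in>int_vecs.
    {Y :: real ^ 'n ^ 'm. h (Y *v q + z - p) < Q powr (- 1 - 1 / real (Suc k))})" for k N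
  have "open (B k N)" for k N
    unfolding B_def matrix_vector_mult_def
    by (intro open_UN ballI open_Collect_less continuous_on_compose2[OF h] continuous_intros) auto
  moreover have "{Y. \<exists>\<epsilon>>0. approximable h b \<epsilon> Y z} = (\<Union>k. \<Inter>N. B k N)"
  proof (intro equalityI subsetI)
    fix Y assume "Y \<in> {Y. \<exists>\<epsilon>>0. approximable h b \<epsilon> Y z}"
    then obtain k where k: "approximable h b (1 / real (Suc k)) Y z" by (auto simp: ex_approximable_iff)
    have "Y \<in> B k N" for N
      using k[unfolded approximable_def, rule_format, of "real N"] unfolding B_def by blast
    then show "Y \<in> (\<Union>k. \<Inter>N. B k N)" by blast
  next
    fix Y assume "Y \<in> (\<Union>k. \<Inter>N. B k N)"
    then obtain k where k: "\<And>N. Y \<in> B k N" by blast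
    have "approximable h b (1 / real (Suc k)) Y z"
      unfolding approximable_def
    proof
      fix Q0 :: real
      obtain N where "Q0 < real N" using reals_Archimedean2 by blast
      then show "\<exists>Q>Q0. Q > 1 \<and> (\<exists>q\<in>int_vecs - {0}. \<exists>p\<in>int_vecs.
        h (Y *v q + z - p) < Q powr (- 1 - 1 / real (Suc k)) \<and> b q \<le> Q)"
        using k[of N] unfolding B_def by (fastforce intro: less_trans)
    qed
    then show "Y \<in> {Y. \<exists>\<epsilon>>0. approximable h b \<epsilon> Y z}" by (auto simp: ex_approximable_iff)
  qed
  ultimately show ?thesis by auto
qed

section \<open>Powers of two, dyadic scales and differences of integer solutions\<close>

lemma eventually_less_linear:
  assumes "0 < (c::real)"
  shows "\<forall>\<^sub>F s in sequentially. d < c * real s"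
proof -
  have "filterlim (\<lambda>s. c * real s) at_top sequentially"
    using assms by (intro filterlim_tendsto_pos_mult_at_top[OF tendsto_const _ filterlim_real_sequentially])
  then show ?thesis by (simp add: filterlim_at_top_dense)
qed

lemma powr_linear_tendsto_0:
  assumes "0 < (c::real)"
  shows "(\<lambda>s. 2 powr (- (c * real s))) \<longlonglongrightarrow> 0"
proof -
  have "2 powr (- (c * real s)) = (2 powr (- c)) ^ s" for s
    by (simp add: powr_powr powr_realpow[symmetric])
  moreover have "2 powr (- c) < 1" using powr_less_mono[of "- c" 0 2] assms by simp
  ultimately show ?thesis by (simp add: LIMSEQ_realpow_zero)
qed

lemma prod_powr_eq: "(0::real) < b \<Longrightarrow> (\<Prod>i\<in>I. b powr f i) = b powr (\<Sum>i\<in>I. f i)"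
  by (simp add: powr_sum)

lemma ex_dyadic:
  assumes "1 < (Q::real)" "2 ^ N < Q"
  obtains s where "N \<le> s" "2 powr real s \<le> Q" "Q < 2 powr (real s + 1)"
proof -
  define s where "s = nat \<lfloor>log 2 Q\<rfloor>"
  have "real N < log 2 Q" using assms by (simp add: less_log_iff powr_realpow)
  then have s: "real s \<le> log 2 Q" "log 2 Q < real s + 1" "N \<le> s"
    unfolding s_def using assms(1) by linarith+
  then show ?thesis
    using that[of s] assms(1) by (simp add: le_log_iff log_less_iff)
qed

text \<open>The shift \<open>z\<close> cancels; \<open>+ 0\<close> keeps the shape of
  \<open>approximable\<close> with zero shift.\<close>

lemma matrix_vector_diff_components:
  fixes Y :: "real ^ 'n ^ 'm"
  shows "(Y *v (q - q') + 0 - (p - p')) $ i = (Y *v q + z - p) $ i - (Y *v q' + z - p') $ i"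
  by (simp add: matrix_vector_mult_diff_distrib)

lemma int_vecs_diff: "p \<in> int_vecs \<Longrightarrow> p' \<in> int_vecs \<Longrightarrow> p - p' \<in> int_vecs"
  by (simp add: int_vecs_def)

lemma Ints_eq_0: "x \<in> \<int> \<Longrightarrow> \<bar>x\<bar> < (1::real) \<Longrightarrow> x = 0"
  using Ints_nonzero_abs_less1 by blast

section \<open>Very well approximable matrices\<close>

lemma powr_divide_power:
  assumes "0 < m"
  shows "(2 powr (- (c / real m * x))) ^ m = 2 powr (- (c * x))"
proof -
  have "(2 powr (- (c / real m * x))) ^ m = (2 powr (- (c / real m * x))) powr real m"
    by (simp add: powr_realpow)
  also have "\<dots> = 2 powr (- (c * x))" using assms by (simp add: powr_powr)
  finally show ?thesis .
qed

text \<open>If \<open>q = q'\<close>, the integers \<open>p $ i\<close> and \<open>p' $ i\<close>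
  differ by less than 1 for \<open>i \<in> S\<close> and agree elsewhere, so the pairs
  coincide.\<close>

lemma close_pair_difference_nonzero:
  fixes Y :: "real ^ 'n ^ 'm"
  assumes ab: "q \<in> int_vecs" "q' \<in> int_vecs" "p \<in> int_vecs" "p' \<in> int_vecs" "(q, p) \<noteq> (q', p')"
    and S: "\<And>i. i \<notin> S \<Longrightarrow> p $ i = p' $ i"
    and close: "\<And>i. i \<in> S \<Longrightarrow> \<bar>(Y *v q + z - p) $ i\<bar> < \<eta> i" "\<And>i. i \<in> S \<Longrightarrow> \<bar>(Y *v q' + z - p') $ i\<bar> < \<eta> i"
    and \<eta>: "\<And>i. i \<in> S \<Longrightarrow> 2 * \<eta> i \<le> 1"
  shows "q - q' \<in> int_vecs - {0}"
proof -
  have "q \<noteq> q'"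
  proof
    assume "q = q'"
    have "p $ i = p' $ i" for i
    proof (cases "i \<in> S")
      case True
      have "(p - p') $ i = (Y *v q' + z - p') $ i - (Y *v q + z - p) $ i"
        by (simp add: \<open>q = q'\<close>)
      then have "\<bar>(p - p') $ i\<bar> < 1"
        using close(1)[OF True] close(2)[OF True] \<eta>[OF True] by linarith
      then have "(p - p') $ i = 0"
        using int_vecs_diff[OF ab(3,4)] by (intro Ints_eq_0) (auto simp: int_vecs_def)
      then show ?thesis by simp
    qed (rule S)
    with ab \<open>q = q'\<close> show False by (simp add: vec_eq_iff)
  qed
  then show ?thesis using int_vecs_diff[OF ab(1,2)] by simp
qed

text \<open>The scale \<open>s\<close> stands for all \<open>Q\<close> with
  \<open>2 powr s \<le> Q < 2 powr (s + 1)\<close>: the upper end bounds \<open>q\<close>, the lower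
  end bounds the error.\<close>

definition VWA_candidates :: "nat \<Rightarrow> ((real ^ 'n) \<times> (real ^ 'm)) set" where
  "VWA_candidates s = {(q, p). q \<in> int_vecs - {0} \<and> p \<in> int_vecs \<and> norm q ^ CARD('n) \<le> 2 powr (real s + 1)}"

lemma VWA_of_close_pairs:
  fixes Y :: "real ^ 'n ^ 'm" and \<eta> :: "nat \<Rightarrow> real"
  assumes "0 < \<epsilon>" and \<eta>_def: "\<And>s. \<eta> s = 2 powr (- ((1 + \<epsilon> / 2) / CARD('m) * real s))"
    and close: "\<exists>\<^sub>F s in sequentially. \<exists>a\<in>VWA_candidates s. \<exists>b\<in>VWA_candidates s. a \<noteq> b \<and>
      (\<forall>i. \<bar>(Y *v fst a + z - snd a) $ i\<bar> < \<eta> s) \<and> (\<forall>i. \<bar>(Y *v fst b + z - snd b) $ i\<bar> < \<eta> s)"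
  shows "VWA Y 0"
  unfolding VWA_iff_approximable
proof (intro exI conjI)
  let ?m = "CARD('m)" and ?n = "CARD('n)"
  show "0 < \<epsilon> / 4" using \<open>0 < \<epsilon>\<close> by simp
  show "approximable (\<lambda>w. norm w ^ CARD('m)) (\<lambda>q. norm q ^ CARD('n)) (\<epsilon> / 4) Y 0"
    unfolding approximable_def
  proof
    fix Q0 :: real
    \<comment> \<open>The summand \<open>n\<close> in the exponent pays for doubling the norm of
      \<open>q\<close> in the difference; \<open>K\<close> below collects the factor
      \<open>2 * m\<close> lost in passing from coordinates to the norm.\<close>
    define Q where "Q s = 2 powr (real ?n + real s + 1)" for s :: nat
    define K where "K = log 2 ((2 * real ?m) ^ ?m)"
    have K: "(2 * real ?m) ^ ?m = 2 powr K" unfolding K_def by (subst powr_log_cancel) auto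
    \<comment> \<open>Three demands on \<open>s\<close>: that \<open>Q s\<close> exceeds
      \<open>Q0\<close>, that \<open>2 * \<eta> s \<le> 1\<close>, and that the remaining surplus
      \<open>\<epsilon> / 4 * s\<close> beats all constants.\<close>
    have "\<forall>\<^sub>F s in sequentially. log 2 (max 1 Q0) < 1 * real s" by (rule eventually_less_linear) simp
    moreover have "\<forall>\<^sub>F s in sequentially. 1 < (1 + \<epsilon> / 2) / ?m * real s"
      by (rule eventually_less_linear) (use \<open>0 < \<epsilon>\<close> in simp)
    moreover have "\<forall>\<^sub>F s in sequentially. K + (real ?n + 1) * (1 + \<epsilon> / 4) < \<epsilon> / 4 * real s"
      by (rule eventually_less_linear) (use \<open>0 < \<epsilon>\<close> in simp)
    ultimately have "\<forall>\<^sub>F s in sequentially. log 2 (max 1 Q0) < 1 * real s \<and> 1 < (1 + \<epsilon> / 2) / ?m * real s \<and>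
        K + (real ?n + 1) * (1 + \<epsilon> / 4) < \<epsilon> / 4 * real s"
      by (intro eventually_conj)
    from frequently_ex[OF frequently_eventually_frequently[OF close this]]
    obtain s a b where s: "log 2 (max 1 Q0) < 1 * real s" "1 < (1 + \<epsilon> / 2) / ?m * real s"
        "K + (real ?n + 1) * (1 + \<epsilon> / 4) < \<epsilon> / 4 * real s"
      and ab: "a \<in> VWA_candidates s" "b \<in> VWA_candidates s" "a \<noteq> b"
        "\<forall>i. \<bar>(Y *v fst a + z - snd a) $ i\<bar> < \<eta> s" "\<forall>i. \<bar>(Y *v fst b + z - snd b) $ i\<bar> < \<eta> s"
      by blast
    obtain q p q' p' where "a = (q, p)" "b = (q', p')" by fastforce
    with ab have qp: "(q, p) \<in> VWA_candidates s" "(q', p') \<in> VWA_candidates s" "(q, p) \<noteq> (q', p')"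
      and c: "\<bar>(Y *v q + z - p) $ i\<bar> < \<eta> s" "\<bar>(Y *v q' + z - p') $ i\<bar> < \<eta> s" for i
      by simp_all
    have \<eta>1: "2 * \<eta> s \<le> 1"
      using powr_mono[of "- ((1 + \<epsilon> / 2) / ?m * real s)" "- 1" 2] s(2) unfolding \<eta>_def by (simp add: powr_minus)
    have "Q0 < Q s"
    proof -
      have "Q0 \<le> max 1 Q0" by simp
      also have "\<dots> < 2 powr real s" using s(1) by (simp add: log_less_iff)
      also have "\<dots> \<le> Q s" unfolding Q_def by (intro powr_mono) auto
      finally show ?thesis .
    qed
    moreover have "1 < Q s" unfolding Q_def by (intro gr_one_powr) auto
    moreover have "q - q' \<in> int_vecs - {0}"
      by (rule close_pair_difference_nonzero[where S = UNIV and Y = Y and z = z and p = p and p' = p' and \<eta> = "\<lambda>_. \<eta> s"])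
        (use qp c \<eta>1 in \<open>auto simp: VWA_candidates_def\<close>)
    moreover have "p - p' \<in> int_vecs"
      using qp by (auto simp: VWA_candidates_def intro: int_vecs_diff)
    moreover have "norm (Y *v (q - q') + 0 - (p - p')) ^ ?m < Q s powr (- 1 - \<epsilon> / 4)"
    proof -
      have "norm (Y *v (q - q') + 0 - (p - p')) \<le> (\<Sum>i\<in>UNIV. \<bar>(Y *v (q - q') + 0 - (p - p')) $ i\<bar>)"
        by (rule norm_le_l1_cart)
      also have "\<dots> \<le> (\<Sum>i\<in>(UNIV :: 'm set). 2 * \<eta> s)"
      proof (rule sum_mono)
        fix i show "\<bar>(Y *v (q - q') + 0 - (p - p')) $ i\<bar> \<le> 2 * \<eta> s"
          unfolding matrix_vector_diff_components[where z = z] using c(1)[of i] c(2)[of i] by linarith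
      qed
      finally have "norm (Y *v (q - q') + 0 - (p - p')) \<le> 2 * real ?m * \<eta> s" by simp
      then have "norm (Y *v (q - q') + 0 - (p - p')) ^ ?m \<le> (2 * real ?m * \<eta> s) ^ ?m"
        by (intro power_mono) auto
      also have "\<dots> = 2 powr K * \<eta> s ^ ?m" by (simp add: power_mult_distrib K[symmetric])
      also have "\<eta> s ^ ?m = 2 powr (- ((1 + \<epsilon> / 2) * real s))"
        unfolding \<eta>_def by (rule powr_divide_power[OF zero_less_card_finite])
      also have "2 powr K * 2 powr (- ((1 + \<epsilon> / 2) * real s)) = 2 powr (K - (1 + \<epsilon> / 2) * real s)"
        by (simp add: powr_add[symmetric])
      also have "\<dots> < 2 powr ((real ?n + real s + 1) * (- 1 - \<epsilon> / 4))"
      proof (rule powr_less_mono)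
        have "K - (1 + \<epsilon> / 2) * real s - (real ?n + real s + 1) * (- 1 - \<epsilon> / 4)
          = K + (real ?n + 1) * (1 + \<epsilon> / 4) - \<epsilon> / 4 * real s"
          by (simp add: field_simps)
        with s(3) show "K - (1 + \<epsilon> / 2) * real s < (real ?n + real s + 1) * (- 1 - \<epsilon> / 4)" by linarith
      qed simp
      also have "\<dots> = Q s powr (- 1 - \<epsilon> / 4)" by (simp add: Q_def powr_powr)
      finally show ?thesis .
    qed
    moreover have "norm (q - q') ^ ?n \<le> Q s"
    proof -
      have "norm (q - q') \<le> 2 * max (norm q) (norm q')" using norm_triangle_ineq4[of q q'] by linarith
      then have "norm (q - q') ^ ?n \<le> (2 * max (norm q) (norm q')) ^ ?n" by (intro power_mono) auto
      also have "\<dots> = 2 ^ ?n * max (norm q) (norm q') ^ ?n" by (rule power_mult_distrib)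
      also have "\<dots> \<le> 2 ^ ?n * 2 powr (real s + 1)"
        using qp by (auto simp: VWA_candidates_def max_def)
      also have "\<dots> = Q s" by (simp add: Q_def powr_add powr_realpow[symmetric] ac_simps)
      finally show ?thesis .
    qed
    ultimately show "\<exists>Q>Q0. Q > 1 \<and> (\<exists>q\<in>int_vecs - {0}. \<exists>p\<in>int_vecs.
      norm (Y *v q + 0 - p) ^ ?m < Q powr (- 1 - \<epsilon> / 4) \<and> norm q ^ ?n \<le> Q)"
      by blast
  qed
qed

lemma VWA_candidates_frequently:
  fixes Y :: "real ^ 'n ^ 'm"
  assumes "0 < \<epsilon>" and ap: "approximable (\<lambda>w. norm w ^ CARD('m)) (\<lambda>q. norm q ^ CARD('n)) \<epsilon> Y z"
  shows "\<exists>\<^sub>F s in sequentially. \<exists>a\<in>VWA_candidates s.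
    \<forall>i. \<bar>(Y *v fst a + z - snd a) $ i\<bar> < 2 powr (- ((1 + \<epsilon>) / CARD('m) * real s))"
  unfolding frequently_sequentially
proof
  let ?m = "CARD('m)"
  fix N :: nat
  from ap[unfolded approximable_def, rule_format, of "2 ^ N"]
  obtain Q q p where Q: "2 ^ N < Q" "1 < Q" "q \<in> int_vecs - {0}" "p \<in> int_vecs"
    "norm (Y *v q + z - p) ^ ?m < Q powr (- 1 - \<epsilon>)" "norm q ^ CARD('n) \<le> Q"
    by blast
  obtain s where s: "N \<le> s" "2 powr real s \<le> Q" "Q < 2 powr (real s + 1)"
    using ex_dyadic[OF Q(2,1)] by blast
  have "(q, p) \<in> VWA_candidates s" using Q s by (simp add: VWA_candidates_def)
  moreover have "\<bar>(Y *v q + z - p) $ i\<bar> < 2 powr (- ((1 + \<epsilon>) / ?m * real s))" for i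
  proof -
    have "\<bar>(Y *v q + z - p) $ i\<bar> \<le> norm (Y *v q + z - p)" by (rule component_le_norm_cart)
    also have "\<dots> < 2 powr (- ((1 + \<epsilon>) / ?m * real s))"
    proof (rule power_less_imp_less_base)
      have "Q powr (- 1 - \<epsilon>) \<le> (2 powr real s) powr (- 1 - \<epsilon>)"
        using s Q \<open>0 < \<epsilon>\<close> by (intro powr_mono2') auto
      also have "\<dots> = 2 powr (- ((1 + \<epsilon>) * real s))" by (simp add: powr_powr algebra_simps)
      also have "\<dots> = (2 powr (- ((1 + \<epsilon>) / ?m * real s))) ^ ?m" by (rule powr_divide_power[OF zero_less_card_finite, symmetric])
      finally show "norm (Y *v q + z - p) ^ ?m < (2 powr (- ((1 + \<epsilon>) / ?m * real s))) ^ ?m" using Q(5) by linarith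
    qed simp
    finally show ?thesis .
  qed
  ultimately show "\<exists>s\<ge>N. \<exists>a\<in>VWA_candidates s. \<forall>i. \<bar>(Y *v fst a + z - snd a) $ i\<bar> < 2 powr (- ((1 + \<epsilon>) / ?m * real s))"
    using s(1) by (intro exI[of _ s] conjI bexI[of _ "(q, p)"]) auto
qed

section \<open>Very well multiplicatively approximable matrices\<close>

text \<open>
  The error \<open>w\<close> and \<open>q\<close> are localised on a grid of mesh \<open>\<kappa>\<close>: \<open>\<bar>w\<^sub>i\<bar>\<close> is about \<open>2 powr (- t\<^sub>i \<kappa> s)\<close> and
  \<open>max 1 \<bar>q\<^sub>j\<bar>\<close> about \<open>2 powr (u\<^sub>j \<kappa> (s + 1))\<close>, so only finitely many pairs \<open>(t, u)\<close> occur, independently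
  of \<open>s\<close>. The summands \<open>1\<close> account for rounding to the grid. The cap \<open>2 / \<kappa>\<close> is harmless: a single
  \<open>t\<^sub>i\<close> reaching it already gives \<open>\<kappa> t\<^sub>i \<ge> 2 \<ge> 1 + \<epsilon>\<close>.
\<close>

definition VWMA_exponents :: "real \<Rightarrow> real \<Rightarrow> (('m::finite \<Rightarrow> nat) \<times> ('n::finite \<Rightarrow> nat)) set" where
  "VWMA_exponents \<kappa> \<epsilon> = {(t, u). (\<forall>i. t i \<le> nat \<lceil>2 / \<kappa>\<rceil>) \<and> (\<forall>j. u j \<le> nat \<lceil>2 / \<kappa>\<rceil>) \<and>
     1 + \<epsilon> \<le> \<kappa> * (\<Sum>i\<in>UNIV. real (t i) + 1) \<and> \<kappa> * (\<Sum>j\<in>UNIV. real (u j) - 1) \<le> 1}"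

text \<open>
  A row with \<open>t i = 0\<close> imposes no smallness and would not determine \<open>p $ i\<close>; it is dropped, and
  \<open>p $ i\<close> is normalised to \<open>0\<close>, so that distinct solutions at the same scale have distinct \<open>q\<close>.
\<close>

definition VWMA_candidates ::
  "real \<Rightarrow> ('m \<Rightarrow> nat) \<Rightarrow> ('n \<Rightarrow> nat) \<Rightarrow> nat \<Rightarrow> ((real ^ 'n) \<times> (real ^ 'm)) set" where
  "VWMA_candidates \<kappa> t u s = {(q, p). q \<in> int_vecs - {0} \<and> p \<in> int_vecs \<and> (\<forall>i. t i = 0 \<longrightarrow> p $ i = 0) \<and>
     (\<forall>j. max 1 \<bar>q $ j\<bar> \<le> 2 powr (real (u j) * \<kappa> * (real s + 1)))}"

lemma finite_VWMA_exponents: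
  "finite (VWMA_exponents \<kappa> \<epsilon> :: (('m::finite \<Rightarrow> nat) \<times> ('n::finite \<Rightarrow> nat)) set)"
proof (rule finite_subset)
  let ?K = "nat \<lceil>2 / \<kappa>\<rceil>"
  show "VWMA_exponents \<kappa> \<epsilon> \<subseteq> (PiE UNIV (\<lambda>_. {..?K}) :: ('m \<Rightarrow> nat) set) \<times> (PiE UNIV (\<lambda>_. {..?K}) :: ('n \<Rightarrow> nat) set)"
    by (auto simp: VWMA_exponents_def PiE_UNIV_domain)
  show "finite ((PiE UNIV (\<lambda>_. {..?K}) :: ('m \<Rightarrow> nat) set) \<times> (PiE UNIV (\<lambda>_. {..?K}) :: ('n \<Rightarrow> nat) set))"
    by (intro finite_cartesian_product finite_PiE) auto
qed

text \<open>The grid cell \<open>(t, u)\<close> is read off from the sizes of the individual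
  coordinates of error and \<open>q\<close>. It depends on \<open>s\<close>, but ranges over a
  finite set.\<close>

lemma VWMA_candidates_frequently:
  fixes Y :: "real ^ 'n ^ 'm"
  assumes \<epsilon>: "0 < \<epsilon>" "\<epsilon> \<le> 1" and "0 < \<kappa>" and ap: "approximable coord_prod coord_prod_plus \<epsilon> Y z"
  shows "\<exists>\<^sub>F s in sequentially. \<exists>(t, u)\<in>VWMA_exponents \<kappa> \<epsilon>. \<exists>a\<in>VWMA_candidates \<kappa> t u s.
    \<forall>i\<in>{i. t i \<noteq> 0}. \<bar>(Y *v fst a + z - snd a) $ i\<bar> < 2 powr (- (real (t i) * \<kappa> * real s))"
  unfolding frequently_sequentially
proof
  define K where "K = nat \<lceil>2 / \<kappa>\<rceil>"
  have "2 / \<kappa> \<le> real K" unfolding K_def by (rule real_nat_ceiling_ge)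
  then have K: "2 \<le> real K * \<kappa>"
    using \<open>0 < \<kappa>\<close> by (simp add: pos_divide_le_eq)
  fix N :: nat
  from ap[unfolded approximable_def, rule_format, of "2 ^ N"]
  obtain Q q p0 where Q: "2 ^ N < Q" "1 < Q" "q \<in> int_vecs - {0}" "p0 \<in> int_vecs"
    "coord_prod (Y *v q + z - p0) < Q powr (- 1 - \<epsilon>)" "coord_prod_plus q \<le> Q"
    by blast
  obtain s where s: "N \<le> s" "2 powr real s \<le> Q" "Q < 2 powr (real s + 1)"
    using ex_dyadic[OF Q(2,1)] by blast
  \<comment> \<open>Replacing \<open>p0\<close> by the nearest integers does not increase any
    coordinate of the error, and it makes every coordinate less than 1, so that
    \<open>t i = 0\<close> is always admissible.\<close>
  define w where "w i = \<bar>(Y *v q + z) $ i - of_int (round ((Y *v q + z) $ i))\<bar>" for i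
  have w1: "w i < 1" for i
  proof -
    have "w i \<le> 1 / 2" unfolding w_def using of_int_round_abs_le[of "(Y *v q + z) $ i"] by linarith
    then show ?thesis by simp
  qed
  have prod_w: "(\<Prod>i\<in>UNIV. w i) < 2 powr (- ((1 + \<epsilon>) * real s))"
  proof -
    have "w i \<le> \<bar>(Y *v q + z - p0) $ i\<bar>" for i
    proof -
      obtain k where "p0 $ i = of_int k" using Q(4) by (auto simp: int_vecs_def elim: Ints_cases)
      then show ?thesis unfolding w_def using round_diff_minimal[of "(Y *v q + z) $ i" k] by simp
    qed
    then have "(\<Prod>i\<in>UNIV. w i) \<le> coord_prod (Y *v q + z - p0)"
      unfolding coord_prod_def by (intro prod_mono) (auto simp: w_def)
    also have "\<dots> < Q powr (- 1 - \<epsilon>)" by (rule Q(5))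
    also have "\<dots> \<le> (2 powr real s) powr (- 1 - \<epsilon>)"
      using s Q \<open>0 < \<epsilon>\<close> by (intro powr_mono2') auto
    also have "\<dots> = 2 powr (- ((1 + \<epsilon>) * real s))" by (simp add: powr_powr algebra_simps)
    finally show ?thesis .
  qed
  \<comment> \<open>The cap \<open>K\<close> makes the greatest exponent exist also when
    \<open>w i = 0\<close>.\<close>
  define t where "t i = (GREATEST k. k \<le> K \<and> w i < 2 powr (- (real k * \<kappa> * real s)))" for i
  have t: "t i \<le> K" "w i < 2 powr (- (real (t i) * \<kappa> * real s))" for i
  proof -
    have "0 \<le> K \<and> w i < 2 powr (- (real 0 * \<kappa> * real s))" using w1 by simp
    from GreatestI_nat[of "\<lambda>k. k \<le> K \<and> w i < 2 powr (- (real k * \<kappa> * real s))", OF this, of K]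
    show "t i \<le> K" "w i < 2 powr (- (real (t i) * \<kappa> * real s))" unfolding t_def by auto
  qed
  have t_max: "2 powr (- ((real (t i) + 1) * \<kappa> * real s)) \<le> w i" if "t i < K" for i
  proof (rule ccontr)
    assume "\<not> ?thesis"
    with that have "t i + 1 \<le> K \<and> w i < 2 powr (- (real (t i + 1) * \<kappa> * real s))" by (simp add: add.commute)
    from Greatest_le_nat[of "\<lambda>k. k \<le> K \<and> w i < 2 powr (- (real k * \<kappa> * real s))", OF this, of K]
    show False unfolding t_def by auto
  qed
  \<comment> \<open>If some \<open>t i\<close> reaches the cap, it alone gives
    \<open>\<kappa> * t i \<ge> 2\<close>. Otherwise \<open>t_max\<close> bounds every factor of the
    product from below.\<close>
  have t_sum: "1 + \<epsilon> \<le> \<kappa> * (\<Sum>i\<in>UNIV. real (t i) + 1)"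
  proof (rule ccontr)
    assume neg: "\<not> ?thesis"
    have "t i < K" for i
    proof (rule ccontr)
      assume "\<not> t i < K"
      have "real (t i) + 1 \<le> (\<Sum>i\<in>UNIV. real (t i) + 1)" by (rule member_le_sum) auto
      then have "\<kappa> * (real (t i) + 1) \<le> \<kappa> * (\<Sum>i\<in>UNIV. real (t i) + 1)" using \<open>0 < \<kappa>\<close> by simp
      moreover have "\<kappa> * real K \<le> \<kappa> * (real (t i) + 1)" using \<open>\<not> t i < K\<close> \<open>0 < \<kappa>\<close> by simp
      ultimately show False using K neg \<epsilon> by (simp add: mult.commute)
    qed
    then have "(\<Prod>i\<in>UNIV. 2 powr (- ((real (t i) + 1) * \<kappa> * real s))) \<le> (\<Prod>i\<in>UNIV. w i)"
      using t_max by (intro prod_mono) auto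
    also have "(\<Prod>i\<in>UNIV. 2 powr (- ((real (t i) + 1) * \<kappa> * real s)))
      = 2 powr (\<Sum>i\<in>UNIV. - ((real (t i) + 1) * \<kappa> * real s))" by (rule prod_powr_eq) simp
    also have "(\<Sum>i\<in>UNIV. - ((real (t i) + 1) * \<kappa> * real s)) = - (\<kappa> * (\<Sum>i\<in>UNIV. real (t i) + 1) * real s)"
      by (simp only: sum_negf sum_distrib_left sum_distrib_right mult.commute mult.assoc mult.left_commute)
    finally have "2 powr (- (\<kappa> * (\<Sum>i\<in>UNIV. real (t i) + 1) * real s)) < 2 powr (- ((1 + \<epsilon>) * real s))"
      using prod_w by linarith
    then have "(1 + \<epsilon>) * real s < \<kappa> * (\<Sum>i\<in>UNIV. real (t i) + 1) * real s" by simp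
    moreover have "\<kappa> * (\<Sum>i\<in>UNIV. real (t i) + 1) * real s \<le> (1 + \<epsilon>) * real s"
      using neg by (intro mult_right_mono) auto
    ultimately show False by linarith
  qed
  have q_le: "max 1 \<bar>q $ j\<bar> \<le> 2 powr (real s + 1)" for j
  proof -
    have "max 1 \<bar>q $ j\<bar> = (\<Prod>k\<in>{j}. max 1 \<bar>q $ k\<bar>)" by simp
    also have "\<dots> \<le> coord_prod_plus q" unfolding coord_prod_plus_def by (rule prod_mono2) auto
    finally show ?thesis using Q(6) s(3) by linarith
  qed
  define u where "u j = (LEAST k. max 1 \<bar>q $ j\<bar> \<le> 2 powr (real k * \<kappa> * (real s + 1)))" for j
  have uK: "max 1 \<bar>q $ j\<bar> \<le> 2 powr (real K * \<kappa> * (real s + 1))" for j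
  proof -
    have "1 * (real s + 1) \<le> real K * \<kappa> * (real s + 1)" using K by (intro mult_right_mono) auto
    then have "2 powr (real s + 1) \<le> 2 powr (real K * \<kappa> * (real s + 1))" by (intro powr_mono) auto
    with q_le[of j] show ?thesis by linarith
  qed
  have u: "u j \<le> K" "max 1 \<bar>q $ j\<bar> \<le> 2 powr (real (u j) * \<kappa> * (real s + 1))" for j
    unfolding u_def using Least_le[of "\<lambda>k. max 1 \<bar>q $ j\<bar> \<le> 2 powr (real k * \<kappa> * (real s + 1))", OF uK]
      LeastI[of "\<lambda>k. max 1 \<bar>q $ j\<bar> \<le> 2 powr (real k * \<kappa> * (real s + 1))", OF uK] by auto
  have u_min: "2 powr ((real (u j) - 1) * \<kappa> * (real s + 1)) \<le> max 1 \<bar>q $ j\<bar>" for j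
  proof (cases "u j")
    \<comment> \<open>No smaller grid exponent exists here, but the left side has a negative
      exponent and is at most 1.\<close>
    case 0
    have "2 powr ((real (u j) - 1) * \<kappa> * (real s + 1)) \<le> 2 powr 0"
      using \<open>0 < \<kappa>\<close> 0 by (intro powr_mono) (auto simp: mult_nonneg_nonneg)
    then show ?thesis by simp
  next
    case (Suc k)
    then have "\<not> max 1 \<bar>q $ j\<bar> \<le> 2 powr (real k * \<kappa> * (real s + 1))"
      using not_less_Least[of k "\<lambda>k. max 1 \<bar>q $ j\<bar> \<le> 2 powr (real k * \<kappa> * (real s + 1))"] unfolding u_def by simp
    then have "2 powr (real k * \<kappa> * (real s + 1)) \<le> max 1 \<bar>q $ j\<bar>" by linarith
    moreover have "real (u j) - 1 = real k" using Suc by simp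
    ultimately show ?thesis by (simp only:)
  qed
  have u_sum: "\<kappa> * (\<Sum>j\<in>UNIV. real (u j) - 1) \<le> 1"
  proof -
    have "2 powr (\<Sum>j\<in>UNIV. (real (u j) - 1) * \<kappa> * (real s + 1)) = (\<Prod>j\<in>UNIV. 2 powr ((real (u j) - 1) * \<kappa> * (real s + 1)))"
      by (rule prod_powr_eq[symmetric]) simp
    also have "\<dots> \<le> coord_prod_plus q"
      unfolding coord_prod_plus_def using u_min by (intro prod_mono) auto
    also have "\<dots> \<le> 2 powr (real s + 1)" using Q(6) s(3) by linarith
    finally have "(\<Sum>j\<in>UNIV. (real (u j) - 1) * \<kappa> * (real s + 1)) \<le> real s + 1" by simp
    also have "(\<Sum>j\<in>UNIV. (real (u j) - 1) * \<kappa> * (real s + 1)) = \<kappa> * (\<Sum>j\<in>UNIV. real (u j) - 1) * (real s + 1)"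
      by (simp only: sum_distrib_left sum_distrib_right mult.commute mult.assoc mult.left_commute)
    finally show ?thesis by simp
  qed
  have "(t, u) \<in> VWMA_exponents \<kappa> \<epsilon>"
    unfolding VWMA_exponents_def K_def[symmetric] using t u t_sum u_sum by simp
  define p where "p = (\<chi> i. if t i = 0 then 0 else of_int (round ((Y *v q + z) $ i)) :: real ^ 'm)"
  have "(q, p) \<in> VWMA_candidates \<kappa> t u s"
    using Q(3) u(2) by (auto simp: VWMA_candidates_def p_def int_vecs_def)
  moreover have "\<bar>(Y *v q + z - p) $ i\<bar> < 2 powr (- (real (t i) * \<kappa> * real s))" if "t i \<noteq> 0" for i
    using t(2)[of i] that by (simp add: w_def p_def)
  ultimately have "\<exists>a\<in>VWMA_candidates \<kappa> t u s.
    \<forall>i\<in>{i. t i \<noteq> 0}. \<bar>(Y *v fst a + z - snd a) $ i\<bar> < 2 powr (- (real (t i) * \<kappa> * real s))"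
    by (intro bexI[of _ "(q, p)"]) auto
  with \<open>(t, u) \<in> VWMA_exponents \<kappa> \<epsilon>\<close> s(1)
  show "\<exists>s\<ge>N. \<exists>(t, u)\<in>VWMA_exponents \<kappa> \<epsilon>. \<exists>a\<in>VWMA_candidates \<kappa> t u s.
    \<forall>i\<in>{i. t i \<noteq> 0}. \<bar>(Y *v fst a + z - snd a) $ i\<bar> < 2 powr (- (real (t i) * \<kappa> * real s))"
    by blast
qed

text \<open>The relaxation is half a grid step in each row. Together with rounding to the grid it
  costs \<open>3 / 2 * m * \<kappa>\<close> in the error exponent and \<open>n * \<kappa>\<close> in
  the size of \<open>q\<close>, which the bounds on \<open>\<kappa>\<close> keep below the
  surplus.\<close>

lemma VWMA_of_close_pairs:
  fixes Y :: "real ^ 'n ^ 'm" and t :: "'m \<Rightarrow> nat" and u :: "'n \<Rightarrow> nat" and \<eta> :: "nat \<Rightarrow> 'm \<Rightarrow> real"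
    and \<kappa> \<epsilon> :: real
  assumes \<epsilon>: "0 < \<epsilon>" "\<epsilon> \<le> 1" and \<kappa>: "0 < \<kappa>" "real CARD('m) * \<kappa> \<le> \<epsilon> / 8" "real CARD('n) * \<kappa> \<le> \<epsilon> / 8"
    and tu: "(t, u) \<in> VWMA_exponents \<kappa> \<epsilon>"
    and \<eta>: "\<And>s i. \<eta> s i = 2 powr (- ((real (t i) - 1 / 2) * \<kappa> * real s))"
    and close: "\<exists>\<^sub>F s in sequentially. \<exists>a\<in>VWMA_candidates \<kappa> t u s. \<exists>b\<in>VWMA_candidates \<kappa> t u s. a \<noteq> b \<and>
      (\<forall>i\<in>{i. t i \<noteq> 0}. \<bar>(Y *v fst a + z - snd a) $ i\<bar> < \<eta> s i) \<and>
      (\<forall>i\<in>{i. t i \<noteq> 0}. \<bar>(Y *v fst b + z - snd b) $ i\<bar> < \<eta> s i)"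
  shows "VWMA Y 0"
  unfolding VWMA_iff_approximable
proof (intro exI conjI)
  define m n where "m = real CARD('m)" and "n = real CARD('n)"
  have m: "m * \<kappa> \<le> \<epsilon> / 8" "n * \<kappa> \<le> \<epsilon> / 8" "0 < m" "0 < n" using \<kappa> by (auto simp: m_def n_def)
  have t_sum: "1 + \<epsilon> - m * \<kappa> \<le> \<kappa> * (\<Sum>i\<in>UNIV. real (t i))" and u_sum: "\<kappa> * (\<Sum>j\<in>UNIV. real (u j)) \<le> 1 + n * \<kappa>"
    using tu by (auto simp: VWMA_exponents_def sum.distrib sum_subtractf m_def n_def algebra_simps)
  show "0 < \<epsilon> / 4" using \<epsilon> by simp
  show "approximable coord_prod coord_prod_plus (\<epsilon> / 4) Y 0"
    unfolding approximable_def
  proof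
    fix Q0 :: real
    \<comment> \<open>\<open>2 powr E s\<close> bounds the size of \<open>q - q'\<close>, with
      \<open>n\<close> for one doubling per coordinate. \<open>A\<close> is the decay rate of the
      error product and \<open>B\<close> the rate required at this \<open>Q\<close>.\<close>
    define E where "E s = n + (1 + n * \<kappa>) * (real s + 1)" for s :: nat
    define A where "A = 1 + \<epsilon> - 3 / 2 * (m * \<kappa>)"
    define B where "B = (1 + \<epsilon> / 4) * (1 + n * \<kappa>)"
    have "B < A"
    proof -
      have "B \<le> (1 + \<epsilon> / 4) * (1 + \<epsilon> / 8)"
        unfolding B_def using m \<epsilon> by (intro mult_left_mono) auto
      also have "\<dots> = 1 + 3 / 8 * \<epsilon> + \<epsilon> * \<epsilon> / 32" by (simp add: algebra_simps)
      also have "\<dots> \<le> 1 + 3 / 8 * \<epsilon> + \<epsilon> * 1 / 32"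
        using mult_left_mono[of \<epsilon> 1 \<epsilon>] \<epsilon> by simp
      also have "\<dots> < 1 + \<epsilon> - 3 / 2 * (\<epsilon> / 8)" using \<epsilon> by simp
      also have "\<dots> \<le> A" unfolding A_def using m(1) by linarith
      finally show ?thesis .
    qed
    have "\<forall>\<^sub>F s in sequentially. log 2 (max 1 Q0) < 1 * real s" by (rule eventually_less_linear) simp
    moreover have "\<forall>\<^sub>F s in sequentially. 1 < \<kappa> / 2 * real s"
      by (rule eventually_less_linear) (use \<kappa> in simp)
    moreover have "\<forall>\<^sub>F s in sequentially. m + (1 + \<epsilon> / 4) * n + B < (A - B) * real s"
      by (rule eventually_less_linear) (use \<open>B < A\<close> in simp)
    ultimately have "\<forall>\<^sub>F s in sequentially. log 2 (max 1 Q0) < 1 * real s \<and> 1 < \<kappa> / 2 * real s \<and>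
        m + (1 + \<epsilon> / 4) * n + B < (A - B) * real s"
      by (intro eventually_conj)
    from frequently_ex[OF frequently_eventually_frequently[OF close this]]
    obtain s a b where s: "log 2 (max 1 Q0) < 1 * real s" "1 < \<kappa> / 2 * real s"
        "m + (1 + \<epsilon> / 4) * n + B < (A - B) * real s"
      and ab: "a \<in> VWMA_candidates \<kappa> t u s" "b \<in> VWMA_candidates \<kappa> t u s" "a \<noteq> b"
        "\<forall>i\<in>{i. t i \<noteq> 0}. \<bar>(Y *v fst a + z - snd a) $ i\<bar> < \<eta> s i"
        "\<forall>i\<in>{i. t i \<noteq> 0}. \<bar>(Y *v fst b + z - snd b) $ i\<bar> < \<eta> s i"
      by blast
    obtain q p q' p' where "a = (q, p)" "b = (q', p')" by fastforce
    with ab have qp: "(q, p) \<in> VWMA_candidates \<kappa> t u s" "(q', p') \<in> VWMA_candidates \<kappa> t u s" "(q, p) \<noteq> (q', p')"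
      and c: "t i \<noteq> 0 \<Longrightarrow> \<bar>(Y *v q + z - p) $ i\<bar> < \<eta> s i" "t i \<noteq> 0 \<Longrightarrow> \<bar>(Y *v q' + z - p') $ i\<bar> < \<eta> s i" for i
      by simp_all
    have \<eta>1: "2 * \<eta> s i \<le> 1" if "t i \<noteq> 0" for i
    proof -
      have "1 / 2 * (\<kappa> * real s) \<le> (real (t i) - 1 / 2) * (\<kappa> * real s)"
        using that \<kappa> by (intro mult_right_mono) auto
      with s(2) have "- ((real (t i) - 1 / 2) * \<kappa> * real s) \<le> - 1" by (simp add: mult.assoc)
      from powr_mono[OF this, of 2] show ?thesis by (simp add: \<eta> powr_minus)
    qed
    \<comment> \<open>A row with \<open>t i = 0\<close> carries no information, so the nearest
      integer is taken there and contributes a factor of at most \<open>1 / 2\<close>.\<close>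
    define P where "P = (\<chi> i. if t i = 0 then of_int (round ((Y *v (q - q')) $ i)) else (p - p') $ i)"
    have "P \<in> int_vecs"
      using qp int_vecs_diff[of p p'] by (auto simp: VWMA_candidates_def P_def int_vecs_def)
    have "Q0 < 2 powr E s"
    proof -
      have "Q0 \<le> max 1 Q0" by simp
      also have "\<dots> < 2 powr real s" using s(1) by (simp add: log_less_iff)
      also have "\<dots> \<le> 2 powr E s"
      proof (rule powr_mono)
        have "1 * real s \<le> (1 + n * \<kappa>) * (real s + 1)" using m \<kappa> by (intro mult_mono) auto
        then show "real s \<le> E s" unfolding E_def using m by simp
      qed simp
      finally show ?thesis .
    qed
    moreover have "1 < 2 powr E s"
      unfolding E_def using m \<kappa> by (intro gr_one_powr) (auto intro!: add_pos_nonneg)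
    moreover have "q - q' \<in> int_vecs - {0}"
      by (rule close_pair_difference_nonzero[where S = "{i. t i \<noteq> 0}" and Y = Y and z = z and p = p and p' = p' and \<eta> = "\<eta> s"])
        (use qp c \<eta>1 in \<open>auto simp: VWMA_candidates_def\<close>)
    moreover note \<open>P \<in> int_vecs\<close>
    moreover have "coord_prod (Y *v (q - q') + 0 - P) < (2 powr E s) powr (- 1 - \<epsilon> / 4)"
    proof -
      have bound: "\<bar>(Y *v (q - q') + 0 - P) $ i\<bar> \<le> 2 powr (1 - (real (t i) - 1 / 2) * \<kappa> * real s)" for i
      proof (cases "t i = 0")
        case True
        have "\<bar>(Y *v (q - q') + 0 - P) $ i\<bar> \<le> 1 / 2"
          using of_int_round_abs_le[of "(Y *v (q - q')) $ i"] True by (simp add: P_def abs_minus_commute)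
        also have "\<dots> \<le> 2 powr 0" by simp
        also have "\<dots> \<le> 2 powr (1 - (real (t i) - 1 / 2) * \<kappa> * real s)"
          using True \<kappa> by (intro powr_mono) auto
        finally show ?thesis .
      next
        case False
        have "(Y *v (q - q') + 0 - P) $ i = (Y *v (q - q') + 0 - (p - p')) $ i" using False by (simp add: P_def)
        also have "\<dots> = (Y *v q + z - p) $ i - (Y *v q' + z - p') $ i" by (rule matrix_vector_diff_components)
        finally have "\<bar>(Y *v (q - q') + 0 - P) $ i\<bar> \<le> 2 * \<eta> s i" using c[OF False] by linarith
        also have "\<dots> = 2 powr (1 - (real (t i) - 1 / 2) * \<kappa> * real s)"
          using powr_add[of 2 1 "- ((real (t i) - 1 / 2) * \<kappa> * real s)"] by (simp add: \<eta>)
        finally show ?thesis .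
      qed
      have "coord_prod (Y *v (q - q') + 0 - P) \<le> (\<Prod>i\<in>UNIV. 2 powr (1 - (real (t i) - 1 / 2) * \<kappa> * real s))"
        unfolding coord_prod_def by (intro prod_mono conjI bound) auto
      also have "\<dots> = 2 powr (\<Sum>i\<in>UNIV. 1 - (real (t i) - 1 / 2) * \<kappa> * real s)"
        by (rule prod_powr_eq) simp
      also have "(\<Sum>i\<in>UNIV. 1 - (real (t i) - 1 / 2) * \<kappa> * real s) = m - \<kappa> * (\<Sum>i\<in>UNIV. real (t i)) * real s + m * \<kappa> / 2 * real s"
      proof -
        have "1 - (real (t i) - 1 / 2) * \<kappa> * real s = (1 + \<kappa> / 2 * real s) - (\<kappa> * real s) * real (t i)" for i
          by (simp add: algebra_simps)
        then have "(\<Sum>i\<in>UNIV. 1 - (real (t i) - 1 / 2) * \<kappa> * real s)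
          = m * (1 + \<kappa> / 2 * real s) - (\<kappa> * real s) * (\<Sum>i\<in>UNIV. real (t i))"
          by (simp only: sum_subtractf sum_distrib_left[symmetric] sum_constant m_def)
        then show ?thesis by (simp add: algebra_simps)
      qed
      also have "2 powr (m - \<kappa> * (\<Sum>i\<in>UNIV. real (t i)) * real s + m * \<kappa> / 2 * real s) < 2 powr (E s * (- 1 - \<epsilon> / 4))"
      proof (rule powr_less_mono)
        have "(1 + \<epsilon> - m * \<kappa>) * real s \<le> \<kappa> * (\<Sum>i\<in>UNIV. real (t i)) * real s"
          using t_sum by (intro mult_right_mono) auto
        then have "m - \<kappa> * (\<Sum>i\<in>UNIV. real (t i)) * real s + m * \<kappa> / 2 * real s \<le> m - A * real s"
          unfolding A_def by (simp add: algebra_simps)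
        also have "m - A * real s < - ((1 + \<epsilon> / 4) * n + B + B * real s)"
          using s(3) by (simp add: algebra_simps)
        also have "\<dots> = E s * (- 1 - \<epsilon> / 4)"
          by (simp add: E_def B_def field_simps)
        finally show "m - \<kappa> * (\<Sum>i\<in>UNIV. real (t i)) * real s + m * \<kappa> / 2 * real s < E s * (- 1 - \<epsilon> / 4)" .
      qed simp
      also have "\<dots> = (2 powr E s) powr (- 1 - \<epsilon> / 4)" by (simp add: powr_powr)
      finally show ?thesis .
    qed
    moreover have "coord_prod_plus (q - q') \<le> 2 powr E s"
    proof -
      have "max 1 \<bar>(q - q') $ j\<bar> \<le> 2 powr (1 + real (u j) * \<kappa> * (real s + 1))" for j
      proof -
        define X where "X = 2 powr (real (u j) * \<kappa> * (real s + 1))"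
        have X: "max 1 \<bar>q $ j\<bar> \<le> X" "max 1 \<bar>q' $ j\<bar> \<le> X"
          using qp by (auto simp: VWMA_candidates_def X_def)
        have "\<bar>(q - q') $ j\<bar> \<le> \<bar>q $ j\<bar> + \<bar>q' $ j\<bar>"
          unfolding vector_minus_component by (rule abs_triangle_ineq4)
        with X have "max 1 \<bar>(q - q') $ j\<bar> \<le> 2 * X" by linarith
        also have "2 * X = 2 powr (1 + real (u j) * \<kappa> * (real s + 1))" by (simp add: X_def powr_add)
        finally show ?thesis .
      qed
      then have "coord_prod_plus (q - q') \<le> (\<Prod>j\<in>UNIV. 2 powr (1 + real (u j) * \<kappa> * (real s + 1)))"
        unfolding coord_prod_plus_def by (intro prod_mono) auto
      also have "\<dots> = 2 powr (\<Sum>j\<in>UNIV. 1 + real (u j) * \<kappa> * (real s + 1))" by (rule prod_powr_eq) simp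
      also have "(\<Sum>j\<in>UNIV. 1 + real (u j) * \<kappa> * (real s + 1)) = n + \<kappa> * (\<Sum>j\<in>UNIV. real (u j)) * (real s + 1)"
        by (simp only: sum.distrib sum_distrib_left sum_distrib_right n_def sum_constant mult_1_right mult.commute mult.assoc mult.left_commute)
      also have "2 powr (n + \<kappa> * (\<Sum>j\<in>UNIV. real (u j)) * (real s + 1)) \<le> 2 powr E s"
        unfolding E_def by (intro powr_mono add_left_mono mult_right_mono u_sum) auto
      finally show ?thesis .
    qed
    ultimately show "\<exists>Q>Q0. Q > 1 \<and> (\<exists>q\<in>int_vecs - {0}. \<exists>p\<in>int_vecs.
      coord_prod (Y *v q + 0 - p) < Q powr (- 1 - \<epsilon> / 4) \<and> coord_prod_plus q \<le> Q)"
      by blast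
  qed
qed

section \<open>From homogeneous to inhomogeneous extremality\<close>

lemma powr_power_mult: "(2 powr a) ^ s * 2 powr b = 2 powr (a * real s + b)"
proof -
  have "(2 powr a) ^ s = 2 powr (a * real s)" by (simp add: powr_powr powr_realpow[symmetric])
  then show ?thesis by (simp only: powr_add)
qed

lemma inhom_not_VWA:
  fixes U :: "(real ^ 'd) set" and \<mu> :: "(real ^ 'd) measure"
    and F :: "real ^ 'd \<Rightarrow> real ^ 'n ^ 'm" and z :: "real ^ 'm"
  assumes "open U" and "radon_measure_on U \<mu>" and "federer_on U \<mu>" and "continuous_on U F"
    and "\<And>j. good_pair U (\<lambda>x. row j (F x)) \<mu>"
    and "\<And>j. nonplanar_pair U (\<lambda>x. row j (F x)) \<mu>"
    and hom: "AE x in \<mu>. \<not> VWA (F x) 0"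
  shows "AE x in \<mu>. \<not> VWA (F x) z"
proof -
  let ?m = "real CARD('m)"
  have "AE x in \<mu>. \<not> approximable (\<lambda>w. norm w ^ CARD('m)) (\<lambda>q. norm q ^ CARD('n)) \<epsilon> (F x) z"
    if "0 < \<epsilon>" for \<epsilon>
  proof -
    define \<theta> where "\<theta> s = 2 powr (- ((1 + \<epsilon>) / ?m * real s))" for s :: nat
    define \<theta>' where "\<theta>' s = 2 powr (- ((1 + \<epsilon> / 2) / ?m * real s))" for s :: nat
    \<comment> \<open>Chosen so that \<open>\<rho> ^ s * \<theta>' s\<close> is exactly
      \<open>\<theta> s\<close>.\<close>
    define \<rho> where "\<rho> = 2 powr (- (\<epsilon> / 2 / ?m))"
    have "AE x in \<mu>. \<forall>\<^sub>F s in sequentially. \<forall>a\<in>VWA_candidates s. \<forall>b\<in>VWA_candidates s.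
      (\<forall>i\<in>UNIV. \<bar>(F x *v fst a + z - snd a) $ i\<bar> < \<theta>' s) \<and>
      (\<forall>i\<in>UNIV. \<bar>(F x *v fst b + z - snd b) $ i\<bar> < \<theta>' s) \<longrightarrow> a = b"
      using hom
    proof eventually_elim
      case (elim x)
      then have "\<not> (\<exists>\<^sub>F s in sequentially. \<exists>a\<in>VWA_candidates s. \<exists>b\<in>VWA_candidates s. a \<noteq> b \<and>
        (\<forall>i. \<bar>(F x *v fst a + z - snd a) $ i\<bar> < \<theta>' s) \<and> (\<forall>i. \<bar>(F x *v fst b + z - snd b) $ i\<bar> < \<theta>' s))"
        using VWA_of_close_pairs[OF \<open>0 < \<epsilon>\<close>, of \<theta>' "F x" z] \<theta>'_def by blast
      then show ?case unfolding not_frequently by (rule eventually_mono) blast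
    qed
    then have "AE x in \<mu>. \<forall>\<^sub>F s in sequentially. \<forall>a\<in>VWA_candidates s.
      \<not> (\<forall>i\<in>UNIV. \<bar>(F x *v fst a + z - snd a) $ i\<bar> < \<theta> s)"
    proof (rule transference[OF assms(1-6), rotated -1])
      show "VWA_candidates s \<subseteq> (int_vecs - {0}) \<times> int_vecs" for s
        by (auto simp: VWA_candidates_def)
      show "0 < \<theta>' s" for s by (simp add: \<theta>'_def)
      show "\<theta> s \<le> \<rho> ^ s * \<theta>' s" for s
      proof -
        have "\<rho> ^ s * \<theta>' s = 2 powr (- (\<epsilon> / 2 / ?m) * real s + - ((1 + \<epsilon> / 2) / ?m * real s))"
          unfolding \<rho>_def \<theta>'_def by (rule powr_power_mult)
        also have "- (\<epsilon> / 2 / ?m) * real s + - ((1 + \<epsilon> / 2) / ?m * real s) = - ((1 + \<epsilon>) / ?m * real s)"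
          by (simp add: field_simps)
        finally show ?thesis by (simp add: \<theta>_def)
      qed
      show "0 < \<rho>" by (simp add: \<rho>_def)
      show "\<rho> < 1" using powr_less_mono[of "- (\<epsilon> / 2 / ?m)" 0 2] \<open>0 < \<epsilon>\<close> by (simp add: \<rho>_def)
      \<comment> \<open>Any row will do, because the threshold is the same for all rows.\<close>
      show "undefined \<in> (UNIV :: 'm set)" by simp
      show "\<theta>' \<longlonglongrightarrow> 0"
        unfolding \<theta>'_def using \<open>0 < \<epsilon>\<close> by (intro powr_linear_tendsto_0) simp
    qed
    then show ?thesis
    proof eventually_elim
      case (elim x)
      then have "\<not> (\<exists>\<^sub>F s in sequentially. \<exists>a\<in>VWA_candidates s. \<forall>i. \<bar>(F x *v fst a + z - snd a) $ i\<bar> < \<theta> s)"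
        unfolding not_frequently by (rule eventually_mono) blast
      then show ?case using VWA_candidates_frequently[OF \<open>0 < \<epsilon>\<close>, of "F x" z] unfolding \<theta>_def by blast
    qed
  qed
  then have "AE x in \<mu>. \<forall>k. \<not> approximable (\<lambda>w. norm w ^ CARD('m)) (\<lambda>q. norm q ^ CARD('n)) (1 / real (Suc k)) (F x) z"
    by (subst AE_all_countable) simp
  then show ?thesis
    unfolding VWA_iff_approximable ex_approximable_iff by eventually_elim blast
qed

lemma inhom_not_VWMA:
  fixes U :: "(real ^ 'd) set" and \<mu> :: "(real ^ 'd) measure"
    and F :: "real ^ 'd \<Rightarrow> real ^ 'n ^ 'm" and z :: "real ^ 'm"
  assumes "open U" and "radon_measure_on U \<mu>" and "federer_on U \<mu>" and "continuous_on U F"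
    and "\<And>j. good_pair U (\<lambda>x. row j (F x)) \<mu>"
    and "\<And>j. nonplanar_pair U (\<lambda>x. row j (F x)) \<mu>"
    and hom: "AE x in \<mu>. \<not> VWMA (F x) 0"
  shows "AE x in \<mu>. \<not> VWMA (F x) z"
proof -
  have "AE x in \<mu>. \<not> approximable coord_prod coord_prod_plus \<epsilon> (F x) z" if \<epsilon>: "0 < \<epsilon>" "\<epsilon> \<le> 1" for \<epsilon>
  proof -
    define N where "N = real CARD('m) + real CARD('n)"
    \<comment> \<open>Gives \<open>m * \<kappa> + n * \<kappa> = \<epsilon> / 8\<close>, hence both
      mesh bounds of \<open>VWMA_of_close_pairs\<close>.\<close>
    define \<kappa> where "\<kappa> = \<epsilon> / (8 * N)"
    have "0 < N" by (simp add: N_def add_pos_pos)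
    then have \<kappa>0: "0 < \<kappa>" "N * \<kappa> = \<epsilon> / 8" using \<epsilon> by (simp_all add: \<kappa>_def)
    then have "real CARD('m) * \<kappa> + real CARD('n) * \<kappa> = \<epsilon> / 8" by (simp add: N_def distrib_right)
    moreover have "0 \<le> real CARD('m) * \<kappa>" "0 \<le> real CARD('n) * \<kappa>" using \<kappa>0(1) by simp_all
    ultimately have \<kappa>: "0 < \<kappa>" "real CARD('m) * \<kappa> \<le> \<epsilon> / 8" "real CARD('n) * \<kappa> \<le> \<epsilon> / 8"
      using \<kappa>0(1) by linarith+
    define \<theta> :: "('m \<Rightarrow> nat) \<Rightarrow> nat \<Rightarrow> 'm \<Rightarrow> real" where "\<theta> t s i = 2 powr (- (real (t i) * \<kappa> * real s))" for t s i
    define \<rho> where "\<rho> = 2 powr (- (\<kappa> / 2))"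
    have tu: "AE x in \<mu>. \<forall>\<^sub>F s in sequentially. \<forall>a\<in>VWMA_candidates \<kappa> t u s.
      \<not> (\<forall>i\<in>{i. t i \<noteq> 0}. \<bar>(F x *v fst a + z - snd a) $ i\<bar> < \<theta> t s i)"
      if tu: "(t, u) \<in> VWMA_exponents \<kappa> \<epsilon>" for t :: "'m \<Rightarrow> nat" and u :: "'n \<Rightarrow> nat"
    proof -
      define \<theta>' where "\<theta>' s i = 2 powr (- ((real (t i) - 1 / 2) * \<kappa> * real s))" for s :: nat and i
      \<comment> \<open>If all \<open>t i\<close> were 0, the exponent condition would force
        \<open>1 + \<epsilon> \<le> m * \<kappa> \<le> \<epsilon> / 8\<close>.\<close>
      obtain i0 where i0: "t i0 \<noteq> 0"
      proof (cases "\<forall>i. t i = 0")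
        case True
        with tu have "1 + \<epsilon> \<le> real CARD('m) * \<kappa>" by (simp add: VWMA_exponents_def mult.commute)
        with \<kappa> \<epsilon> show ?thesis by linarith
      qed (use that in blast)
      have "AE x in \<mu>. \<forall>\<^sub>F s in sequentially. \<forall>a\<in>VWMA_candidates \<kappa> t u s. \<forall>b\<in>VWMA_candidates \<kappa> t u s.
        (\<forall>i\<in>{i. t i \<noteq> 0}. \<bar>(F x *v fst a + z - snd a) $ i\<bar> < \<theta>' s i) \<and>
        (\<forall>i\<in>{i. t i \<noteq> 0}. \<bar>(F x *v fst b + z - snd b) $ i\<bar> < \<theta>' s i) \<longrightarrow> a = b"
        using hom
      proof eventually_elim
        case (elim x)
        then have "\<not> (\<exists>\<^sub>F s in sequentially. \<exists>a\<in>VWMA_candidates \<kappa> t u s. \<exists>b\<in>VWMA_candidates \<kappa> t u s. a \<noteq> b \<and>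
          (\<forall>i\<in>{i. t i \<noteq> 0}. \<bar>(F x *v fst a + z - snd a) $ i\<bar> < \<theta>' s i) \<and>
          (\<forall>i\<in>{i. t i \<noteq> 0}. \<bar>(F x *v fst b + z - snd b) $ i\<bar> < \<theta>' s i))"
          using VWMA_of_close_pairs[OF \<epsilon> \<kappa> tu, of \<theta>' "F x" z] \<theta>'_def by blast
        then show ?case unfolding not_frequently by (rule eventually_mono) blast
      qed
      then show ?thesis
      proof (rule transference[OF assms(1-6), rotated -1])
        show "VWMA_candidates \<kappa> t u s \<subseteq> (int_vecs - {0}) \<times> int_vecs" for s
          by (auto simp: VWMA_candidates_def)
        show "0 < \<theta>' s i" for s i by (simp add: \<theta>'_def)
        show "\<theta> t s i \<le> \<rho> ^ s * \<theta>' s i" for s i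
        proof -
          have "\<rho> ^ s * \<theta>' s i = 2 powr (- (\<kappa> / 2) * real s + - ((real (t i) - 1 / 2) * \<kappa> * real s))"
            unfolding \<rho>_def \<theta>'_def by (rule powr_power_mult)
          also have "- (\<kappa> / 2) * real s + - ((real (t i) - 1 / 2) * \<kappa> * real s) = - (real (t i) * \<kappa> * real s)"
            by (simp add: field_simps)
          finally show ?thesis by (simp add: \<theta>_def)
        qed
        show "0 < \<rho>" by (simp add: \<rho>_def)
        show "\<rho> < 1" using powr_less_mono[of "- (\<kappa> / 2)" 0 2] \<kappa>(1) by (simp add: \<rho>_def)
        show "i0 \<in> {i. t i \<noteq> 0}" using i0 by simp
        have "0 < (real (t i0) - 1 / 2) * \<kappa>" using i0 \<kappa>(1) by (intro mult_pos_pos) auto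
        then show "(\<lambda>s. \<theta>' s i0) \<longlonglongrightarrow> 0"
          unfolding \<theta>'_def by (rule powr_linear_tendsto_0)
      qed
    qed
    \<comment> \<open>Finiteness of the set of cells is used twice: to unite the null sets, and to
      choose one threshold for \<open>s\<close> valid for all cells.\<close>
    have "AE x in \<mu>. \<forall>(t, u)\<in>VWMA_exponents \<kappa> \<epsilon>. \<forall>\<^sub>F s in sequentially. \<forall>a\<in>VWMA_candidates \<kappa> t u s.
      \<not> (\<forall>i\<in>{i. t i \<noteq> 0}. \<bar>(F x *v fst a + z - snd a) $ i\<bar> < \<theta> t s i)"
      using tu by (intro AE_finite_allI finite_VWMA_exponents) auto
    then show ?thesis
    proof eventually_elim
      case (elim x)
      then have "\<forall>\<^sub>F s in sequentially. \<forall>v\<in>VWMA_exponents \<kappa> \<epsilon>. case v of (t, u) \<Rightarrow> \<forall>a\<in>VWMA_candidates \<kappa> t u s.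
        \<not> (\<forall>i\<in>{i. t i \<noteq> 0}. \<bar>(F x *v fst a + z - snd a) $ i\<bar> < \<theta> t s i)"
        by (intro eventually_ball_finite finite_VWMA_exponents) auto
      then have "\<not> (\<exists>\<^sub>F s in sequentially. \<exists>(t, u)\<in>VWMA_exponents \<kappa> \<epsilon>. \<exists>a\<in>VWMA_candidates \<kappa> t u s.
        \<forall>i\<in>{i. t i \<noteq> 0}. \<bar>(F x *v fst a + z - snd a) $ i\<bar> < \<theta> t s i)"
        unfolding not_frequently by (rule eventually_mono) blast
      then show ?case using VWMA_candidates_frequently[OF \<epsilon> \<kappa>(1), of "F x" z] unfolding \<theta>_def by blast
    qed
  qed
  then have "AE x in \<mu>. \<forall>k. \<not> approximable coord_prod coord_prod_plus (1 / real (Suc k)) (F x) z"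
    by (subst AE_all_countable) simp
  then show ?thesis
    unfolding VWMA_iff_approximable ex_approximable_iff by eventually_elim blast
qed

section \<open>Passage to the image measure\<close>

theorem theorem6p1:
  fixes U :: "(real ^ 'd) set"
    and \<mu> :: "(real ^ 'd) measure"
    and F :: "real ^ 'd \<Rightarrow> real ^ 'n ^ 'm"
  assumes "open U"
    and "radon_measure_on U \<mu>"
    and "federer_on U \<mu>"
    and "continuous_on U F"
    and "\<And>j. good_pair U (\<lambda>x. row j (F x)) \<mu>"
    and "\<And>j. nonplanar_pair U (\<lambda>x. row j (F x)) \<mu>"
  shows "(extremal (distr \<mu> borel F) \<longleftrightarrow> inhom_extremal (distr \<mu> borel F)) \<and>
    (strongly_extremal (distr \<mu> borel F) \<longleftrightarrow> inhom_strongly_extremal (distr \<mu> borel F))"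
proof -
  have sets: "sets \<mu> = sets (restrict_space borel U)"
    using assms(2) by (simp add: radon_measure_on_def)
  have F: "F \<in> measurable \<mu> borel"
    using borel_measurable_continuous_on_restrict[OF assms(4)] measurable_cong_sets[OF sets refl] by blast
  have "{Y. VWA Y z} \<in> sets borel" for z :: "real ^ 'm"
    unfolding VWA_iff_approximable by (intro sets_approximable continuous_intros)
  then have VWA: "(AE Y in distr \<mu> borel F. \<not> VWA Y z) \<longleftrightarrow> (AE x in \<mu>. \<not> VWA (F x) z)" for z
    using F by (intro AE_distr_iff) (auto simp: Collect_neg_eq intro!: borel_comp)
  have "continuous_on UNIV (coord_prod :: real ^ 'm \<Rightarrow> real)"
    unfolding coord_prod_def by (intro continuous_intros)
  then have "{Y. VWMA Y z} \<in> sets borel" for z :: "real ^ 'm"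
    unfolding VWMA_iff_approximable by (rule sets_approximable)
  then have VWMA: "(AE Y in distr \<mu> borel F. \<not> VWMA Y z) \<longleftrightarrow> (AE x in \<mu>. \<not> VWMA (F x) z)" for z
    using F by (intro AE_distr_iff) (auto simp: Collect_neg_eq intro!: borel_comp)
  \<comment> \<open>The implications from inhomogeneous to homogeneous are the case
    \<open>z = 0\<close>.\<close>
  show ?thesis
    unfolding extremal_def inhom_extremal_def strongly_extremal_def inhom_strongly_extremal_def VWA VWMA
    using inhom_not_VWA[OF assms] inhom_not_VWMA[OF assms] by blast
qed

end
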